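(* Let $\{\varphi_r\}_{0<r<1}$ be an arbitrary approximate identity and let $\lambda:(0,1)\to(0,\infty)$ with $\lim_{r\to1}\lambda(r)=0$ satisfy $$\Pi(\lambda,\varphi)=\limsup_{r\to1}\lambda(r)\|\varphi_r\|_\infty=\infty .$$ Then there exists a function $f\in L^1(\mathbb T)$ such that $$\limsup_{\substack{r\to1\\ y\in\lambda(r,x)}}\Phi_r(y,f)=\infty$$ for all $x\in\mathbb T$.
   Context: $\mathbb T=\mathbb R/2\pi\mathbb Z$; points are represented by $t$ with $|t|\le\pi$. An approximate identity is a family $\{\varphi_r\}_{0<r<1}\subset L^\infty(\mathbb T)$ such that: ($\Phi1$) $\int_{\mathbb T}\varphi_r(t)\,dt\to1$ as $r\to1$; ($\Phi2$) $\varphi_r^*(x):=\sup_{|x|\le|t|\le\pi}|\varphi_r(t)|\to0$ as $r\to1$ for each $0<|x|\le\pi$; ($\Phi3$) $C_\varphi:=\sup_{0<r<1}\|\varphi_r^*\|_1<\infty$. $\Phi_r(x,f):=\int_{\mathbb T}\varphi_r(x-t)f(t)\,dt$ for $f\in L^1(\mathbb T)$. $\lambda(r,x)$ is the interval $[x-\lambda(r),x+\lambda(r)]\subset\mathbb T$ (equal to $\mathbb T$ if $\lambda(r)\ge\pi$), and $\limsup_{r\to1,\ y\in\lambda(r,x)}F_r(y)$ means $\limsup_{r\to1}\sup_{y\in\lambda(r,x)}F_r(y)$. *)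

theory Defs
  imports "HOL-Analysis.Analysis" "HOL-Probability.Essential_Supremum"
begin

text \<open>Functions on \<open>\<T> = \<real>/2\<pi>\<int>\<close> are encoded as \<open>2\<pi>\<close>-periodic functions on \<open>\<real>\<close>,
  and \<open>[-\<pi>, \<pi>]\<close> with unnormalised Lebesgue measure serves as a fundamental domain
  (its two endpoints are the same point of \<open>\<T>\<close>, which is a null set).\<close>

abbreviation circle_measure :: "real measure" where
  "circle_measure \<equiv> lebesgue_on {-pi..pi}"

definition periodic_2pi :: "(real \<Rightarrow> 'a) \<Rightarrow> bool" where
  "periodic_2pi f \<longleftrightarrow> (\<forall>t. f (t + 2 * pi) = f t)"

definition L1_circle :: "(real \<Rightarrow> real) set" where
  "L1_circle = {f. periodic_2pi f \<and> integrable circle_measure f}"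

definition Linf_norm :: "(real \<Rightarrow> real) \<Rightarrow> ennreal" where
  "Linf_norm g = esssup circle_measure (\<lambda>t. ennreal \<bar>g t\<bar>)"

definition Linf_circle :: "(real \<Rightarrow> real) set" where
  "Linf_circle =
    {g. periodic_2pi g \<and> g \<in> borel_measurable circle_measure \<and> Linf_norm g < \<infinity>}"

text \<open>The supremum of \<open>\<bar>g\<bar>\<close> over \<open>\<bar>x\<bar> \<le> \<bar>t\<bar> \<le> \<pi>\<close>. As \<open>g\<close> stands for an element of
  \<open>L\<^sup>\<infinity>(\<T>)\<close>, it is the essential supremum, independent of the representative; in particular
  \<open>star_majorant g 0 = Linf_norm g\<close>. It is at most the pointwise supremum of any
  representative. In \<open>ennreal\<close> the value over a null set (the case \<open>\<bar>x\<bar> = \<pi>\<close>) is \<open>0\<close>.\<close>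

definition star_majorant :: "(real \<Rightarrow> real) \<Rightarrow> real \<Rightarrow> ennreal" where
  "star_majorant g x =
    esssup (lebesgue_on {t. \<bar>x\<bar> \<le> \<bar>t\<bar> \<and> \<bar>t\<bar> \<le> pi}) (\<lambda>t. ennreal \<bar>g t\<bar>)"

text \<open>Only the values \<open>\<phi> r\<close> with \<open>0 < r < 1\<close> matter; \<open>r \<rightarrow> 1\<close> is the filter \<open>at_left 1\<close>.\<close>

definition approximate_identity :: "(real \<Rightarrow> real \<Rightarrow> real) \<Rightarrow> bool" where
  "approximate_identity \<phi> \<longleftrightarrow>
    (\<forall>r\<in>{0<..<1}. \<phi> r \<in> Linf_circle) \<and>
    ((\<lambda>r. \<integral>t. \<phi> r t \<partial>circle_measure) \<longlongrightarrow> 1) (at_left 1) \<and>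
    (\<forall>x. 0 < \<bar>x\<bar> \<and> \<bar>x\<bar> \<le> pi \<longrightarrow> ((\<lambda>r. star_majorant (\<phi> r) x) \<longlongrightarrow> 0) (at_left 1)) \<and>
    (SUP r\<in>{0<..<1}. \<integral>\<^sup>+x. star_majorant (\<phi> r) x \<partial>circle_measure) < \<infinity>"

definition kernel_integral :: "(real \<Rightarrow> real \<Rightarrow> real) \<Rightarrow> real \<Rightarrow> real \<Rightarrow> (real \<Rightarrow> real) \<Rightarrow> real" where
  "kernel_integral \<phi> r x f = (\<integral>t. \<phi> r (x - t) * f t \<partial>circle_measure)"

text \<open>The interval is taken in \<open>\<real>\<close>; the integral being \<open>2\<pi>\<close>-periodic in its point argument,
  this agrees with its projection to \<open>\<T>\<close>, including the case \<open>\<lambda>(r) \<ge> \<pi>\<close>.\<close>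

definition approach_limsup :: "(real \<Rightarrow> real) \<Rightarrow> (real \<Rightarrow> real \<Rightarrow> real) \<Rightarrow> real \<Rightarrow> ereal" where
  "approach_limsup lam F x =
    Limsup (at_left 1) (\<lambda>r. SUP y\<in>{x - lam r..x + lam r}. ereal (F r y))"

definition Pi_quantity :: "(real \<Rightarrow> real) \<Rightarrow> (real \<Rightarrow> real \<Rightarrow> real) \<Rightarrow> ennreal" where
  "Pi_quantity lam \<phi> = Limsup (at_left 1) (\<lambda>r. ennreal (lam r) * Linf_norm (\<phi> r))"

end

theory Submission
  imports Defs
begin

text \<open>
  The proof is a gliding hump argument. Write \<open>\<parallel>\<phi>\<^sub>r\<parallel>\<^sub>\<infinity>\<close> for the norm of a kernel and let \<open>C\<close> bound
  the integrals of all the majorants \<open>\<phi>\<^sub>r\<^sup>*\<close>.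

  One hump (\<open>hump_exists\<close>, \<open>spread_hump_exists\<close>). Fix \<open>r\<close> and a lattice of \<open>N\<close> points on the circle
  with mesh \<open>h = 2\<pi>/N\<close> comparable with \<open>\<lambda>(r)\<close>. If \<open>h \<parallel>\<phi>\<^sub>r\<parallel>\<^sub>\<infinity>\<close> is large against \<open>C\<close>, then \<open>\<phi>\<^sub>r\<close>
  exceeds half its norm, with one of the two signs, on a set \<open>E\<close> of positive measure inside
  \<open>(-h/2, h/2)\<close> (\<open>peak_set_exists\<close>). Put mass \<open>\<epsilon>/N\<close>, up to a constant, uniformly on the reflected copy of
  \<open>E\<close> around each lattice point. At a lattice point the nearest copy contributes at least
  a fixed fraction of \<open>\<epsilon> \<parallel>\<phi>\<^sub>r\<parallel>\<^sub>\<infinity> / N\<close>, that is, of \<open>\<epsilon> \<lambda>(r) \<parallel>\<phi>\<^sub>r\<parallel>\<^sub>\<infinity>\<close>. The other copies contribute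
  at most a constant times \<open>\<epsilon> C\<close>, because they are dominated by a lower Riemann sum for the integral of
  the decreasing majorant (\<open>nn_integral_translates_le\<close>). Since \<open>\<lambda>(r) \<parallel>\<phi>\<^sub>r\<parallel>\<^sub>\<infinity>\<close> is unbounded as
  \<open>r \<rightarrow> 1\<close>, a function of arbitrarily small \<open>L\<^sup>1\<close> norm has a large convolution at some point
  within \<open>\<lambda>(r)\<close> of every \<open>x\<close>, for some \<open>r\<close> close to \<open>1\<close>. Taking \<open>E\<close> itself as the
  profile of the bump, rather than a short interval, makes differentiation of integrals superfluous.

  Superposition (\<open>gliding_hump_sequence\<close>, \<open>hump_series_diverges\<close>). The humps are bounded functions and
  the kernels have \<open>L\<^sup>1\<close> norms at most \<open>L = 2 C + 1\<close> (\<open>nn_integral_Linf_circle_le\<close>), so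
  finitely many humps disturb all convolutions by a bounded amount that the next hump can be made to
  exceed. Later humps disturb an earlier stage by at most the norm of its kernel times their
  total mass, and the masses are chosen so small that this product is at most \<open>2\<close>. The sum of all humps is therefore integrable and has the
  required divergence.
\<close>

section \<open>Reflection and translation of integrals over a period\<close>

lemma periodic_2pi_plus_of_int:
  assumes "periodic_2pi F"
  shows "F (t + of_int k * (2 * pi)) = F t"
proof -
  interpret periodic_fun_simple F "2 * pi"
    using assms by unfold_locales (simp add: periodic_2pi_def)
  show ?thesis by (rule plus_of_int)
qed

lemma measurable_lebesgue_reflect:
  assumes "F \<in> lebesgue \<rightarrow>\<^sub>M M"
  shows "(\<lambda>t::real. F (a - t)) \<in> lebesgue \<rightarrow>\<^sub>M M"
proof -
  have "(\<lambda>x::real. a + (-1) * x) \<in> lebesgue \<rightarrow>\<^sub>M lebesgue"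
    using lebesgue_affine_measurable[where c= "\<lambda>x::real. -1" and t=a] by simp
  from measurable_compose[OF this assms] show ?thesis by simp
qed

lemma translate_sets_lebesgue:
  assumes "S \<in> sets lebesgue"
  shows "{t::real. t - a \<in> S} \<in> sets lebesgue"
proof -
  have "{t. t - a \<in> S} = (\<lambda>x. a + x) ` S"
    by (force simp: image_iff algebra_simps)
  then show ?thesis
    using lebesgue_sets_translation[OF assms, of a] by simp
qed

lemma emeasure_lebesgue_translate:
  assumes "S \<in> sets lebesgue"
  shows "emeasure lebesgue {t::real. t - a \<in> S} = emeasure lebesgue S"
proof -
  have "emeasure lebesgue {t::real. t - a \<in> S} = (\<integral>\<^sup>+t. indicator {t. t - a \<in> S} t \<partial>lebesgue)"
    using translate_sets_lebesgue[OF assms] by simp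
  also have "\<dots> = (\<integral>\<^sup>+t. indicator {t. t - a \<in> S} (a + 1 * t) \<partial>lebesgue)"
    using translate_sets_lebesgue[OF assms]
    by (subst nn_integral_real_affine_lebesgue[where c=1 and t=a]) auto
  also have "\<dots> = (\<integral>\<^sup>+t. indicator S t \<partial>lebesgue)"
    by (intro nn_integral_cong) (auto simp: indicator_def)
  finally show ?thesis using assms by simp
qed

text \<open>The kernels come with measurability on \<open>[-\<pi>, \<pi>]\<close> only, while a convolution evaluates them at
  \<open>x - t\<close>. A preimage under a periodic function is the union of countably many translates of its
  part in the fundamental domain.\<close>

lemma periodic_2pi_measurable_lebesgue:
  assumes per: "periodic_2pi F" and F: "F \<in> circle_measure \<rightarrow>\<^sub>M M"
  shows "F \<in> lebesgue \<rightarrow>\<^sub>M M"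
proof (rule measurableI)
  show "F x \<in> space M" if "x \<in> space lebesgue" for x
  proof -
    define k where "k = \<lfloor>(x + pi) / (2 * pi)\<rfloor>"
    have "of_int k \<le> (x + pi) / (2 * pi)" "(x + pi) / (2 * pi) < of_int k + 1"
      unfolding k_def by linarith+
    then have "x + of_int (-k) * (2 * pi) \<in> {-pi..pi}"
      by (auto simp: field_simps)
    then have "F (x + of_int (-k) * (2 * pi)) \<in> space M"
      using measurable_space[OF F] by simp
    then show ?thesis using periodic_2pi_plus_of_int[OF per, of x "-k"] by simp
  qed
next
  fix B assume "B \<in> sets M"
  then have "F -` B \<inter> {-pi..pi} \<in> sets circle_measure"
    using measurable_sets[OF F] by simp
  then have B: "F -` B \<inter> {-pi..pi} \<in> sets lebesgue"
    by (subst (asm) sets_restrict_space_iff) auto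
  have "F -` B = (\<Union>k::int. {t. t - of_int k * (2 * pi) \<in> F -` B \<inter> {-pi..pi}})" (is "_ = ?R")
  proof
    show "?R \<subseteq> F -` B"
      using periodic_2pi_plus_of_int[OF per, of "_ - _"] by (auto; metis diff_add_cancel)
    show "F -` B \<subseteq> ?R"
    proof
      fix x assume x: "x \<in> F -` B"
      define k where "k = \<lfloor>(x + pi) / (2 * pi)\<rfloor>"
      have "of_int k \<le> (x + pi) / (2 * pi)" "(x + pi) / (2 * pi) < of_int k + 1"
        unfolding k_def by linarith+
      then have "x - of_int k * (2 * pi) \<in> {-pi..pi}"
        by (auto simp: field_simps)
      moreover have "F (x - of_int k * (2 * pi)) = F x"
        using periodic_2pi_plus_of_int[OF per, of "x - of_int k * (2 * pi)" k] by simp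
      ultimately show "x \<in> ?R" using x by (intro UN_I[of k]) auto
    qed
  qed
  also have "\<dots> \<in> sets lebesgue"
    by (rule sets.countable_UN''[OF countableI_type], rule translate_sets_lebesgue[OF B])
  finally show "F -` B \<inter> space lebesgue \<in> sets lebesgue" by simp
qed

text \<open>Half-open intervals tile the line without overlap, so the period arguments are carried out with
  \<open>[-\<pi>, \<pi>)\<close>; the lost endpoint is a null set.\<close>

lemma nn_integral_circle_eq:
  fixes F :: "real \<Rightarrow> ennreal"
  shows "(\<integral>\<^sup>+t. F t \<partial>circle_measure) = (\<integral>\<^sup>+t. F t * indicator {-pi..<pi} t \<partial>lebesgue)"
proof -
  have "AE t in lebesgue. t \<noteq> (pi::real)"
    by (rule AE_I'[of "{pi}"]) (auto simp: null_sets_completionI)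
  then have "(\<integral>\<^sup>+t. F t * indicator {-pi..pi} t \<partial>lebesgue) = (\<integral>\<^sup>+t. F t * indicator {-pi..<pi} t \<partial>lebesgue)"
    by (intro nn_integral_cong_AE) (auto elim!: eventually_mono simp: indicator_def)
  then show ?thesis by (simp add: nn_integral_restrict_space)
qed

lemma borel_measurable_lebesgue_times_Ico:
  fixes F :: "real \<Rightarrow> ennreal"
  assumes "F \<in> borel_measurable lebesgue"
  shows "(\<lambda>t. F t * indicator {u..<v} t) \<in> borel_measurable lebesgue"
  using assms by (intro borel_measurable_times_ennreal borel_measurable_indicator) auto

lemma nn_integral_translate_period:
  fixes F :: "real \<Rightarrow> ennreal"
  assumes per: "periodic_2pi F" and F: "F \<in> borel_measurable lebesgue"
  shows "(\<integral>\<^sup>+t. F t * indicator {u + of_int k * (2 * pi)..<v + of_int k * (2 * pi)} t \<partial>lebesgue)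
       = (\<integral>\<^sup>+t. F t * indicator {u..<v} t \<partial>lebesgue)"
proof -
  define a where "a = of_int k * (2 * pi)"
  have "(\<integral>\<^sup>+t. F t * indicator {u + a..<v + a} t \<partial>lebesgue)
     = (\<integral>\<^sup>+t. F (a + 1 * t) * indicator {u + a..<v + a} (a + 1 * t) \<partial>lebesgue)"
    by (subst nn_integral_real_affine_lebesgue[where c=1 and t=a,
         OF borel_measurable_lebesgue_times_Ico[OF F]]) auto
  also have "\<dots> = (\<integral>\<^sup>+t. F t * indicator {u..<v} t \<partial>lebesgue)"
    using periodic_2pi_plus_of_int[OF per, of _ k]
    by (intro nn_integral_cong) (auto simp: a_def indicator_def add.commute)
  finally show ?thesis by (simp add: a_def)
qed

lemma nn_integral_split_Ico:
  fixes F :: "real \<Rightarrow> ennreal"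
  assumes F: "F \<in> borel_measurable lebesgue" and "u \<le> v" "v \<le> w"
  shows "(\<integral>\<^sup>+t. F t * indicator {u..<w} t \<partial>lebesgue)
     = (\<integral>\<^sup>+t. F t * indicator {u..<v} t \<partial>lebesgue) + (\<integral>\<^sup>+t. F t * indicator {v..<w} t \<partial>lebesgue)"
proof -
  have "(\<integral>\<^sup>+t. F t * indicator {u..<w} t \<partial>lebesgue) =
    (\<integral>\<^sup>+t. F t * indicator {u..<v} t + F t * indicator {v..<w} t \<partial>lebesgue)"
    using assms by (intro nn_integral_cong) (auto simp: indicator_def)
  then show ?thesis by (simp add: nn_integral_add borel_measurable_lebesgue_times_Ico[OF F])
qed

text \<open>Cut \<open>[a, a + 2\<pi>)\<close> at the point \<open>q\<close> congruent to \<open>-\<pi>\<close> that it contains, and move the left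
  piece by one period to the right: the result is \<open>[q, q + 2\<pi>)\<close>, a translate of the
  fundamental domain by a multiple of \<open>2\<pi>\<close>.\<close>

lemma nn_integral_period_interval:
  fixes F :: "real \<Rightarrow> ennreal"
  assumes per: "periodic_2pi F" and F: "F \<in> borel_measurable lebesgue"
  shows "(\<integral>\<^sup>+t. F t * indicator {a..<a + 2 * pi} t \<partial>lebesgue) = (\<integral>\<^sup>+t. F t \<partial>circle_measure)"
proof -
  define k where "k = \<lceil>(a + pi) / (2 * pi)\<rceil>"
  define q where "q = - pi + of_int k * (2 * pi)"
  have "of_int k - 1 < (a + pi) / (2 * pi)" "(a + pi) / (2 * pi) \<le> of_int k"
    unfolding k_def by linarith+
  then have q: "a \<le> q" "q \<le> a + 2 * pi"
    by (auto simp: field_simps q_def)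
  have "(\<integral>\<^sup>+t. F t * indicator {a..<a + 2 * pi} t \<partial>lebesgue)
    = (\<integral>\<^sup>+t. F t * indicator {a..<q} t \<partial>lebesgue) + (\<integral>\<^sup>+t. F t * indicator {q..<a + 2*pi} t \<partial>lebesgue)"
    by (rule nn_integral_split_Ico[OF F q])
  also have "(\<integral>\<^sup>+t. F t * indicator {a..<q} t \<partial>lebesgue) = (\<integral>\<^sup>+t. F t * indicator {a+2*pi..<q+2*pi} t \<partial>lebesgue)"
    using nn_integral_translate_period[OF per F, of a 1 q] by simp
  also have "\<dots> + (\<integral>\<^sup>+t. F t * indicator {q..<a + 2*pi} t \<partial>lebesgue)
    = (\<integral>\<^sup>+t. F t * indicator {q..<q + 2*pi} t \<partial>lebesgue)"
    using nn_integral_split_Ico[OF F, of q "a+2*pi" "q+2*pi"] q by (simp add: add.commute)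
  also have "\<dots> = (\<integral>\<^sup>+t. F t * indicator {-pi..<pi} t \<partial>lebesgue)"
    using nn_integral_translate_period[OF per F, of "-pi" k pi] by (simp add: q_def algebra_simps)
  finally show ?thesis by (simp add: nn_integral_circle_eq)
qed

lemma nn_integral_circle_reflect:
  fixes F :: "real \<Rightarrow> ennreal"
  assumes per: "periodic_2pi F" and F: "F \<in> borel_measurable lebesgue"
  shows "(\<integral>\<^sup>+t. F (a - t) \<partial>circle_measure) = (\<integral>\<^sup>+t. F t \<partial>circle_measure)"
proof -
  have "(\<integral>\<^sup>+t. F t \<partial>circle_measure) = (\<integral>\<^sup>+t. F t * indicator {a - pi..<a - pi + 2 * pi} t \<partial>lebesgue)"
    by (rule nn_integral_period_interval[OF per F, symmetric])
  also have "\<dots> = (\<integral>\<^sup>+t. F (a + -1 * t) * indicator {a - pi..<a - pi + 2 * pi} (a + -1 * t) \<partial>lebesgue)"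
    by (subst nn_integral_real_affine_lebesgue[where c="-1" and t=a,
         OF borel_measurable_lebesgue_times_Ico[OF F]]) auto
  also have "\<dots> = (\<integral>\<^sup>+t. F (a - t) * indicator {-pi..<pi} t \<partial>lebesgue)"
  proof (intro nn_integral_cong_AE)
    have "AE t in lebesgue. t \<noteq> (pi::real)" "AE t in lebesgue. t \<noteq> (-pi::real)"
      by (rule AE_I'[of "{pi}"], auto simp: null_sets_completionI)
         (rule AE_I'[of "{-pi}"], auto simp: null_sets_completionI)
    then show "AE x in lebesgue. F (a + - 1 * x) * indicator {a - pi..<a - pi + 2 * pi} (a + - 1 * x) =
                    F (a - x) * indicator {- pi..<pi} x"
      by eventually_elim (auto simp: indicator_def)
  qed
  finally show ?thesis by (simp add: nn_integral_circle_eq)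
qed

text \<open>Reflection invariance passes from nonnegative functions to signed ones through the positive and
  the negative part.\<close>

lemma integral_circle_reflect:
  fixes F :: "real \<Rightarrow> real"
  assumes per: "periodic_2pi F" and F: "F \<in> borel_measurable lebesgue"
    and int: "integrable circle_measure F"
  shows "integrable circle_measure (\<lambda>t. F (a - t))"
    and "(\<integral>t. F (a - t) \<partial>circle_measure) = (\<integral>t. F t \<partial>circle_measure)"
proof -
  have eq: "(\<integral>\<^sup>+t. ennreal (G (F (a - t))) \<partial>circle_measure) = (\<integral>\<^sup>+t. ennreal (G (F t)) \<partial>circle_measure)"
    if [measurable]: "G \<in> borel_measurable borel" for G
    using per F by (intro nn_integral_circle_reflect) (auto simp: periodic_2pi_def)
  have "(\<lambda>t. F (a - t)) \<in> borel_measurable circle_measure"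
    using measurable_lebesgue_reflect[OF F] by (rule measurable_restrict_space1)
  then show *: "integrable circle_measure (\<lambda>t. F (a - t))"
    using int eq[of norm] by (auto simp: integrable_iff_bounded)
  show "(\<integral>t. F (a - t) \<partial>circle_measure) = (\<integral>t. F t \<partial>circle_measure)"
    using eq[of "\<lambda>x. x"] eq[of "\<lambda>x. -x"]
    by (simp add: real_lebesgue_integral_def[OF *] real_lebesgue_integral_def[OF int])
qed

text \<open>The exceptional set \<open>{M < F}\<close> is periodic, so the invariance of the integral of its indicator
  under \<open>t \<mapsto> a - t\<close> transports null sets.\<close>

lemma AE_circle_reflect:
  assumes per: "periodic_2pi F" and [measurable]: "F \<in> borel_measurable lebesgue"
    and le: "AE t in circle_measure. F t \<le> (M::ennreal)"
  shows "AE t in circle_measure. F (a - t) \<le> M"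
proof -
  let ?G = "\<lambda>t. indicator {x. M < F x} t :: ennreal"
  have G: "?G \<in> borel_measurable lebesgue" by measurable
  have c: "?G \<in> borel_measurable circle_measure" "(\<lambda>t. ?G (a - t)) \<in> borel_measurable circle_measure"
    by (rule measurable_restrict_space1[OF G],
        rule measurable_restrict_space1[OF measurable_lebesgue_reflect[OF G]])
  have "AE t in circle_measure. ?G t = 0"
    using le by eventually_elim (auto simp: indicator_def)
  then have "(\<integral>\<^sup>+t. ?G t \<partial>circle_measure) = 0"
    by (subst nn_integral_0_iff_AE[OF c(1)])
  then have "(\<integral>\<^sup>+t. ?G (a - t) \<partial>circle_measure) = 0"
    using nn_integral_circle_reflect[OF _ G, of a] per by (simp add: periodic_2pi_def indicator_def)
  then have "AE t in circle_measure. ?G (a - t) = 0"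
    by (subst (asm) nn_integral_0_iff_AE[OF c(2)])
  then show ?thesis
    by eventually_elim (auto simp: indicator_def split: if_splits)
qed

section \<open>Essential majorants and Riemann sums\<close>

lemma Linf_circle_measurable_lebesgue:
  assumes "g \<in> Linf_circle" shows "g \<in> borel_measurable lebesgue"
  using assms periodic_2pi_measurable_lebesgue by (auto simp: Linf_circle_def)

lemma measurable_circle_of_lebesgue:
  assumes "F \<in> borel_measurable lebesgue" shows "F \<in> borel_measurable circle_measure"
  by (rule measurable_restrict_space1[OF assms])

lemma sets_annulus: "{t::real. x \<le> \<bar>t\<bar> \<and> \<bar>t\<bar> \<le> y} \<in> sets lebesgue"
proof -
  have "{t::real. x \<le> \<bar>t\<bar> \<and> \<bar>t\<bar> \<le> y} \<in> sets borel" by measurable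
  then show ?thesis by simp
qed

lemma AE_le_star_majorant:
  shows "AE t in lebesgue. \<bar>x\<bar> \<le> \<bar>t\<bar> \<longrightarrow> \<bar>t\<bar> \<le> pi \<longrightarrow> ennreal \<bar>g t\<bar> \<le> star_majorant g x"
proof -
  have "AE t in lebesgue_on {t. \<bar>x\<bar> \<le> \<bar>t\<bar> \<and> \<bar>t\<bar> \<le> pi}. ennreal \<bar>g t\<bar> \<le> star_majorant g x"
    unfolding star_majorant_def by (rule esssup_AE)
  then show ?thesis
    by (subst (asm) AE_restrict_space_iff) (auto simp: sets_annulus)
qed

lemma star_majorant_leI:
  assumes "g \<in> Linf_circle"
    and "AE t in lebesgue. \<bar>x\<bar> \<le> \<bar>t\<bar> \<longrightarrow> \<bar>t\<bar> \<le> pi \<longrightarrow> ennreal \<bar>g t\<bar> \<le> c"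
  shows "star_majorant g x \<le> c"
  unfolding star_majorant_def
proof (rule esssup_I)
  show "(\<lambda>t. ennreal \<bar>g t\<bar>) \<in> borel_measurable (lebesgue_on {t. \<bar>x\<bar> \<le> \<bar>t\<bar> \<and> \<bar>t\<bar> \<le> pi})"
    using Linf_circle_measurable_lebesgue[OF assms(1)] by (intro measurable_restrict_space1) measurable
  show "AE t in lebesgue_on {t. \<bar>x\<bar> \<le> \<bar>t\<bar> \<and> \<bar>t\<bar> \<le> pi}. ennreal \<bar>g t\<bar> \<le> c"
    using assms(2) by (subst AE_restrict_space_iff) (auto simp: sets_annulus)
qed

lemma star_majorant_antimono:
  assumes "g \<in> Linf_circle" "\<bar>x\<bar> \<le> \<bar>y\<bar>"
  shows "star_majorant g y \<le> star_majorant g x"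
  using AE_le_star_majorant[of x g] assms(2)
  by (intro star_majorant_leI[OF assms(1)]) (auto elim!: eventually_mono)

lemma star_majorant_beyond_pi:
  assumes "g \<in> Linf_circle" "pi < \<bar>x\<bar>"
  shows "star_majorant g x = 0"
proof -
  have "star_majorant g x \<le> 0"
    using assms(2) by (intro star_majorant_leI[OF assms(1)]) auto
  then show ?thesis by simp
qed

lemma emeasure_half_annulus:
  fixes h :: real and n :: nat
  assumes "h > 0"
  shows "emeasure lebesgue {t. of_nat n * h < \<bar>t\<bar> \<and> \<bar>t\<bar> \<le> (of_nat n + 1/2) * h} = ennreal h"
proof -
  let ?a = "of_nat n * h" and ?b = "(of_nat n + 1/2) * h"
  have a: "0 \<le> ?a" "?a \<le> ?b" using assms by (auto simp: algebra_simps)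
  have "{t. ?a < \<bar>t\<bar> \<and> \<bar>t\<bar> \<le> ?b} = {?a<..?b} \<union> {-?b..<-?a}"
    using a by auto
  moreover have "emeasure lebesgue ({?a<..?b} \<union> {-?b..<-?a})
      = emeasure lebesgue {?a<..?b} + emeasure lebesgue {-?b..<-?a}"
    using a by (intro plus_emeasure[symmetric]) auto
  moreover have "\<dots> = ennreal (?b - ?a) + ennreal (?b - ?a)"
    using a by (simp add: emeasure_lborel_Ioc emeasure_lborel_Ico)
  moreover have "\<dots> = ennreal h"
    using assms by (subst ennreal_plus[symmetric]) (auto simp: algebra_simps)
  ultimately show ?thesis by metis
qed

text \<open>A lower Riemann sum for the even function \<open>star_majorant g\<close>, which decreases in \<open>\<bar>x\<bar>\<close>: its value at
  \<open>(n + 1/2) h\<close> bounds it from below on the set \<open>n h < \<bar>t\<bar> \<le> (n + 1/2) h\<close> of measure \<open>h\<close>. Only every second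
  interval of length \<open>h/2\<close> is used, because a set inside \<open>[-h/2, h/2]\<close> that is moved by \<open>n + 1\<close>
  steps \<open>h\<close> stays at distance at least \<open>(n + 1/2) h\<close> from the origin.\<close>

lemma star_majorant_sum_le:
  assumes g: "g \<in> Linf_circle" and h: "h > 0"
  shows "(\<Sum>n. ennreal h * star_majorant g ((of_nat n + 1/2) * h))
    \<le> (\<integral>\<^sup>+x. star_majorant g x \<partial>circle_measure)"
proof -
  define A where "A n = {t::real. of_nat n * h < \<bar>t\<bar> \<and> \<bar>t\<bar> \<le> (of_nat n + 1/2) * h}" for n :: nat
  define c where "c n = star_majorant g ((of_nat n + 1/2) * h)" for n :: nat
  have A [measurable]: "A n \<in> sets lebesgue" for n
  proof -
    have "A n \<in> sets borel" unfolding A_def by measurable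
    then show ?thesis by simp
  qed
  have "(\<Sum>n. ennreal h * c n) = (\<Sum>n. \<integral>\<^sup>+t. c n * indicator (A n) t \<partial>lebesgue)"
    by (intro suminf_cong) (simp add: nn_integral_cmult_indicator A A_def[symmetric]
        emeasure_half_annulus[OF h, folded A_def] mult.commute)
  also have "\<dots> = (\<integral>\<^sup>+t. (\<Sum>n. c n * indicator (A n) t) \<partial>lebesgue)"
    by (rule nn_integral_suminf[symmetric]) auto
  also have "\<dots> \<le> (\<integral>\<^sup>+t. star_majorant g t * indicator {-pi..pi} t \<partial>lebesgue)"
  proof (rule nn_integral_mono)
    fix t :: real
    show "(\<Sum>n. c n * indicator (A n) t) \<le> star_majorant g t * indicator {-pi..pi} t"
    proof (cases "\<exists>n. t \<in> A n")
      case False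
      then show ?thesis by simp
    next
      case True
      then obtain n where n: "t \<in> A n" by blast
      have "m = n" if "t \<in> A m" for m
      proof -
        have "of_nat n * h < (of_nat m + 1) * h" "of_nat m * h < (of_nat n + 1) * h"
          using n that h by (auto simp: A_def algebra_simps)
        then have "real n < real m + 1" "real m < real n + 1"
          using h by (auto dest: mult_right_less_imp_less)
        then show ?thesis by linarith
      qed
      then have "(\<Sum>n. c n * indicator (A n) t) = (\<Sum>n\<in>{n}. c n * indicator (A n) t)"
        by (intro suminf_finite) (auto simp: indicator_def)
      \<comment> \<open>The sets \<open>A n\<close> are disjoint, so the series has a single nonzero term.\<close>
      then have eq: "(\<Sum>n. c n * indicator (A n) t) = c n" using n by simp
      have le: "\<bar>t\<bar> \<le> \<bar>(of_nat n + 1/2) * h\<bar>" using n h by (auto simp: A_def)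
      show ?thesis
      proof (cases "\<bar>t\<bar> \<le> pi")
        case True
        then show ?thesis using star_majorant_antimono[OF g le] eq by (auto simp: c_def abs_le_iff)
      next
        case False
        \<comment> \<open>Sets \<open>A n\<close> reaching beyond \<open>\<pi>\<close> do no harm: there the majorant is an essential supremum over
          the empty set.\<close>
        then have "c n = 0" using le by (auto simp: c_def intro!: star_majorant_beyond_pi[OF g])
        then show ?thesis using eq by simp
      qed
    qed
  qed
  also have "\<dots> = (\<integral>\<^sup>+x. star_majorant g x \<partial>circle_measure)"
    by (simp add: nn_integral_restrict_space)
  finally show ?thesis by (simp add: c_def)
qed

lemma star_majorant_half_step_le:
  assumes g: "g \<in> Linf_circle" and h: "h > 0"
  shows "ennreal h * star_majorant g (h / 2) \<le> (\<integral>\<^sup>+x. star_majorant g x \<partial>circle_measure)"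
proof -
  have "ennreal h * star_majorant g (h / 2) \<le> (\<Sum>n. ennreal h * star_majorant g ((of_nat n + 1/2) * h))"
    using sum_le_suminf[of "\<lambda>n. ennreal h * star_majorant g ((of_nat n + 1/2) * h)" "{0}"] by simp
  then show ?thesis using star_majorant_sum_le[OF g h] by simp
qed

definition translates :: "real \<Rightarrow> real set \<Rightarrow> real set" where
  "translates h E = {t. \<exists>j::int. j \<noteq> 0 \<and> t - of_int j * h \<in> E}"

lemma translates_eq_UN:
  "translates h E = (\<Union>n::nat. {t. t - (of_nat n + 1) * h \<in> E} \<union> {t. t - (- (of_nat n + 1) * h) \<in> E})"
    (is "_ = ?R")
proof
  show "translates h E \<subseteq> ?R"
  proof
    fix t assume "t \<in> translates h E"
    then obtain j :: int where j: "j \<noteq> 0" "t - of_int j * h \<in> E" by (auto simp: translates_def)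
    define n where "n = nat (\<bar>j\<bar> - 1)"
    have "real_of_int j = of_nat n + 1 \<or> real_of_int j = - (of_nat n + 1)"
      using j(1) by (auto simp: n_def)
    then show "t \<in> ?R" using j(2) by (intro UN_I[of n]) auto
  qed
  show "?R \<subseteq> translates h E"
    unfolding translates_def
  proof safe
    fix t n assume "t - (of_nat n + 1) * h \<in> E"
    then show "\<exists>j. j \<noteq> 0 \<and> t - real_of_int j * h \<in> E"
      by (intro exI[of _ "int n + 1"]) auto
  next
    fix t n assume "t - (- (of_nat n + 1) * h) \<in> E"
    then show "\<exists>j. j \<noteq> 0 \<and> t - real_of_int j * h \<in> E"
      by (intro exI[of _ "- (int n + 1)"]) auto
  qed
qed

lemma sets_translates:
  assumes E: "E \<in> sets lebesgue"
  shows "translates h E \<in> sets lebesgue"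
  unfolding translates_eq_UN
  by (intro sets.countable_UN''[OF countableI_type] sets.Un translate_sets_lebesgue[OF E])

text \<open>The far copies of a set \<open>E\<close> pick up little of the mass of \<open>g\<close>: on the copy around \<open>j h\<close>
  the function is at most the majorant at \<open>(\<bar>j\<bar> - 1/2) h\<close>, so the copies together contribute at most
  \<open>2 \<bar>E\<bar> / h\<close> times the Riemann sum above. The bound is the same whatever the shape of \<open>E\<close>; it is
  stated after multiplication by \<open>h\<close> to avoid division in \<open>ennreal\<close>.\<close>

lemma nn_integral_translates_le:
  assumes g: "g \<in> Linf_circle" and h: "h > 0"
    and E: "E \<in> sets lebesgue" "E \<subseteq> {-(h/2)..h/2}"
  shows "ennreal h * (\<integral>\<^sup>+t. ennreal \<bar>g t\<bar> * indicator (translates h E) t \<partial>circle_measure)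
    \<le> 2 * emeasure lebesgue E * (\<integral>\<^sup>+x. star_majorant g x \<partial>circle_measure)"
proof -
  note [measurable] = Linf_circle_measurable_lebesgue[OF g]
  define c where "c n = star_majorant g ((of_nat n + 1/2) * h)" for n :: nat
  define U where "U n = {t. t - (of_nat n + 1) * h \<in> E}" for n :: nat
  define V where "V n = {t. t - (- (of_nat n + 1) * h) \<in> E}" for n :: nat
  have UV: "U n \<in> sets lebesgue" "V n \<in> sets lebesgue" for n
    unfolding U_def V_def by (rule translate_sets_lebesgue[OF E(1)])+
  have em: "emeasure lebesgue (U n) = emeasure lebesgue E" "emeasure lebesgue (V n) = emeasure lebesgue E" for n
    unfolding U_def V_def by (rule emeasure_lebesgue_translate[OF E(1)])+
  have far: "(of_nat n + 1/2) * h \<le> \<bar>t\<bar>" if "t \<in> U n \<or> t \<in> V n" for n t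
    using that E(2) by (auto simp: U_def V_def algebra_simps abs_if subset_iff)
  have "(\<integral>\<^sup>+t. ennreal \<bar>g t\<bar> * indicator (translates h E) t \<partial>circle_measure)
     = (\<integral>\<^sup>+t. ennreal \<bar>g t\<bar> * indicator (translates h E) t * indicator {-pi..pi} t \<partial>lebesgue)"
    by (simp add: nn_integral_restrict_space)
  also have "\<dots> \<le> (\<integral>\<^sup>+t. (\<Sum>n. c n * (indicator (U n) t + indicator (V n) t)) \<partial>lebesgue)"
  proof (rule nn_integral_mono_AE)
    have "AE t in lebesgue. \<forall>n. \<bar>(of_nat n + 1/2) * h\<bar> \<le> \<bar>t\<bar> \<longrightarrow> \<bar>t\<bar> \<le> pi \<longrightarrow> ennreal \<bar>g t\<bar> \<le> c n"
      unfolding c_def by (subst AE_all_countable) (intro allI AE_le_star_majorant)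
    then show "AE t in lebesgue. ennreal \<bar>g t\<bar> * indicator (translates h E) t * indicator {-pi..pi} t
        \<le> (\<Sum>n. c n * (indicator (U n) t + indicator (V n) t))"
    proof (eventually_elim)
      case (elim t)
      show ?case
      proof (cases "t \<in> translates h E \<and> \<bar>t\<bar> \<le> pi")
        case True
        then obtain n where n: "t \<in> U n \<or> t \<in> V n"
          unfolding translates_eq_UN U_def V_def by blast
        have "\<bar>(of_nat n + 1/2) * h\<bar> \<le> \<bar>t\<bar>" using far[OF n] h by simp
        then have "ennreal \<bar>g t\<bar> \<le> c n * 1" using elim True by simp
        also have "\<dots> \<le> c n * (indicator (U n) t + indicator (V n) t)"
          using n by (intro mult_left_mono) (auto simp: indicator_def)
        also have "\<dots> \<le> (\<Sum>n. c n * (indicator (U n) t + indicator (V n) t))"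
          using sum_le_suminf[of "\<lambda>n. c n * (indicator (U n) t + indicator (V n) t)" "{n}"] by simp
        finally show ?thesis using True by (simp add: abs_le_iff)
      qed (auto simp: indicator_def abs_le_iff)
    qed
  qed
  also have "\<dots> = (\<Sum>n. \<integral>\<^sup>+t. c n * (indicator (U n) t + indicator (V n) t) \<partial>lebesgue)"
    using UV by (intro nn_integral_suminf) auto
  also have "\<dots> = (\<Sum>n. (2 * emeasure lebesgue E) * c n)"
    using UV by (intro suminf_cong) (simp add: nn_integral_cmult nn_integral_add em mult.commute mult_2)
  finally have "ennreal h * (\<integral>\<^sup>+t. ennreal \<bar>g t\<bar> * indicator (translates h E) t \<partial>circle_measure)
     \<le> ennreal h * (\<Sum>n. (2 * emeasure lebesgue E) * c n)"
    by (rule mult_left_mono) simp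
  also have "\<dots> = (2 * emeasure lebesgue E) * (\<Sum>n. ennreal h * c n)"
    by (subst (1 2) ennreal_suminf_cmult) (simp add: mult_ac)
  also have "\<dots> \<le> (2 * emeasure lebesgue E) * (\<integral>\<^sup>+x. star_majorant g x \<partial>circle_measure)"
    unfolding c_def by (intro mult_left_mono star_majorant_sum_le[OF g h]) simp
  finally show ?thesis .
qed

section \<open>The \<open>L\<^sup>1\<close> norm and the peak of a kernel\<close>

text \<open>For members of \<open>Linf_circle\<close> the norm is finite, and this real number carries it; the estimates
  below are arithmetic in the reals.\<close>

definition sup_norm :: "(real \<Rightarrow> real) \<Rightarrow> real" where
  "sup_norm g = enn2real (Linf_norm g)"

lemma Linf_norm_eq_sup_norm:
  assumes "g \<in> Linf_circle" shows "Linf_norm g = ennreal (sup_norm g)"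
  using assms by (auto simp: Linf_circle_def sup_norm_def)

lemma sup_norm_nonneg: "0 \<le> sup_norm g"
  by (simp add: sup_norm_def)

lemma AE_le_sup_norm:
  assumes "g \<in> Linf_circle" shows "AE t in circle_measure. \<bar>g t\<bar> \<le> sup_norm g"
proof -
  have "AE t in circle_measure. ennreal \<bar>g t\<bar> \<le> Linf_norm g"
    unfolding Linf_norm_def by (rule esssup_AE)
  then show ?thesis by (simp add: Linf_norm_eq_sup_norm[OF assms] sup_norm_nonneg)
qed

lemma AE_reflect_le_sup_norm:
  assumes "g \<in> Linf_circle" shows "AE t in circle_measure. \<bar>g (a - t)\<bar> \<le> sup_norm g"
proof -
  note [measurable] = Linf_circle_measurable_lebesgue[OF assms]
  have "AE t in circle_measure. ennreal \<bar>g (a - t)\<bar> \<le> ennreal (sup_norm g)"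
    using assms AE_le_sup_norm[OF assms]
    by (intro AE_circle_reflect[of "\<lambda>t. ennreal \<bar>g t\<bar>"]) (auto simp: periodic_2pi_def Linf_circle_def sup_norm_nonneg)
  then show ?thesis by (simp add: sup_norm_nonneg)
qed

text \<open>That \<open>\<parallel>g\<parallel>\<^sub>1\<close> is controlled by the integral of the majorant follows from the bound on translates
  with \<open>E = [-h/2, h/2]\<close>, whose translates cover the line. The central copy contributes at most
  \<open>h \<parallel>g\<parallel>\<^sub>\<infinity>\<close>, which is at most \<open>1\<close> for \<open>h\<close> small. This avoids comparing \<open>g\<close> with its majorant almost
  everywhere, which is awkward because the majorant is an essential supremum over a set depending
  on the point.\<close>

lemma nn_integral_Linf_circle_le:
  assumes g: "g \<in> Linf_circle"
    and C: "(\<integral>\<^sup>+x. star_majorant g x \<partial>circle_measure) \<le> ennreal C" "0 \<le> C"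
  shows "(\<integral>\<^sup>+t. ennreal \<bar>g t\<bar> \<partial>circle_measure) \<le> ennreal (2 * C + 1)"
proof -
  note [measurable] = Linf_circle_measurable_lebesgue[OF g]
  define h where "h = 1 / (sup_norm g + 1)"
  define E where "E = {-(h/2)..h/2}"
  have h: "h > 0" "sup_norm g * h \<le> 1"
    using sup_norm_nonneg[of g] by (auto simp: h_def)
  have E: "E \<in> sets lebesgue" "E \<subseteq> {-(h/2)..h/2}" "emeasure lebesgue E = ennreal h"
    using h by (auto simp: E_def emeasure_lborel_Icc)
  note T = sets_translates[OF E(1), of h]
  have c: "S \<in> sets lebesgue \<Longrightarrow> (\<lambda>t. ennreal \<bar>g t\<bar> * indicator S t) \<in> borel_measurable circle_measure" for S
    by (intro measurable_restrict_space1) auto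
  have near: "(\<integral>\<^sup>+t. ennreal \<bar>g t\<bar> * indicator E t \<partial>circle_measure) \<le> ennreal 1"
  proof -
    have "(\<integral>\<^sup>+t. ennreal \<bar>g t\<bar> * indicator E t \<partial>circle_measure)
        \<le> (\<integral>\<^sup>+t. ennreal (sup_norm g) * indicator E t \<partial>circle_measure)"
      using AE_le_sup_norm[OF g]
      by (intro nn_integral_mono_AE) (auto elim!: eventually_mono simp: indicator_def sup_norm_nonneg)
    also have "\<dots> \<le> (\<integral>\<^sup>+t. ennreal (sup_norm g) * indicator E t \<partial>lebesgue)"
      by (subst nn_integral_restrict_space) (auto intro!: nn_integral_mono simp: indicator_def)
    also have "\<dots> = ennreal (sup_norm g) * ennreal h"
      using E by (simp add: nn_integral_cmult_indicator)
    also have "\<dots> \<le> ennreal 1"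
      using h sup_norm_nonneg[of g] by (subst ennreal_mult[symmetric]) (auto simp: ennreal_leI)
    finally show ?thesis .
  qed
  have far: "(\<integral>\<^sup>+t. ennreal \<bar>g t\<bar> * indicator (translates h E) t \<partial>circle_measure) \<le> ennreal (2 * C)"
  proof -
    have "ennreal h * (\<integral>\<^sup>+t. ennreal \<bar>g t\<bar> * indicator (translates h E) t \<partial>circle_measure)
      \<le> 2 * ennreal h * (\<integral>\<^sup>+x. star_majorant g x \<partial>circle_measure)"
      using nn_integral_translates_le[OF g h(1) E(1,2)] E(3) by simp
    also have "\<dots> \<le> ennreal h * (2 * ennreal C)"
      using C by (subst mult.commute[of 2], subst mult.assoc) (intro mult_left_mono, auto)
    finally show ?thesis
      using h C by (subst (asm) ennreal_mult_le_mult_iff) (auto simp: ennreal_mult)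
  qed
  have "t \<in> E \<or> t \<in> translates h E" for t
  proof (cases "\<lfloor>t / h + 1/2\<rfloor> = 0")
    case True
    then have "0 \<le> t / h + 1/2" "t / h + 1/2 < 1" by linarith+
    then show ?thesis using h by (simp add: E_def field_simps)
  next
    case False
    define j where "j = \<lfloor>t / h + 1/2\<rfloor>"
    have "of_int j \<le> t / h + 1/2" "t / h + 1/2 < of_int j + 1" unfolding j_def by linarith+
    then have "t - of_int j * h \<in> E" using h by (simp add: E_def field_simps)
    then show ?thesis using False by (auto simp: translates_def j_def)
  qed
  then have "(\<integral>\<^sup>+t. ennreal \<bar>g t\<bar> \<partial>circle_measure) \<le>
     (\<integral>\<^sup>+t. ennreal \<bar>g t\<bar> * indicator E t + ennreal \<bar>g t\<bar> * indicator (translates h E) t \<partial>circle_measure)"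
    by (intro nn_integral_mono) (auto simp: indicator_def)
  also have "\<dots> = (\<integral>\<^sup>+t. ennreal \<bar>g t\<bar> * indicator E t \<partial>circle_measure) +
     (\<integral>\<^sup>+t. ennreal \<bar>g t\<bar> * indicator (translates h E) t \<partial>circle_measure)"
    using E T c by (intro nn_integral_add) auto
  also have "\<dots> \<le> ennreal 1 + ennreal (2 * C)"
    using near far by (rule add_mono)
  also have "\<dots> = ennreal (2 * C + 1)"
    using C by (subst ennreal_plus[symmetric]) (auto simp: add.commute)
  finally show ?thesis .
qed

text \<open>Outside \<open>\<bar>s\<bar> < h/2\<close> the function is at most its majorant at \<open>h/2\<close>, hence at most
  \<open>C / h \<le> \<parallel>g\<parallel>\<^sub>\<infinity> / 2\<close>. So values close to the norm must be taken on a set of positive measure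
  near the origin. The kernel may be signed, and it is not known which of the two signs produces
  this set.\<close>

lemma peak_set_exists:
  assumes g: "g \<in> Linf_circle"
    and C: "(\<integral>\<^sup>+x. star_majorant g x \<partial>circle_measure) \<le> ennreal C" "0 \<le> C"
    and h: "0 < h" "h \<le> 2 * pi" and M: "0 < sup_norm g" "2 * C \<le> sup_norm g * h"
  obtains \<sigma> E where "\<sigma> = 1 \<or> \<sigma> = (-1::real)"
    and "E = {s. \<bar>s\<bar> < h / 2 \<and> sup_norm g / 2 < \<sigma> * g s}" "E \<in> lmeasurable" "0 < measure lebesgue E"
proof -
  note [measurable] = Linf_circle_measurable_lebesgue[OF g]
  define E where "E \<sigma> = {s. \<bar>s\<bar> < h / 2 \<and> sup_norm g / 2 < \<sigma> * g s}" for \<sigma>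
  have E_sets: "E \<sigma> \<in> sets lebesgue" for \<sigma>
  proof -
    have "{s \<in> space lebesgue. sup_norm g / 2 < \<sigma> * g s} \<in> sets lebesgue"
      by measurable
    then have "{-(h/2)<..<h/2} \<inter> {s \<in> space lebesgue. sup_norm g / 2 < \<sigma> * g s} \<in> sets lebesgue"
      by (intro sets.Int) simp_all
    also have "{-(h/2)<..<h/2} \<inter> {s \<in> space lebesgue. sup_norm g / 2 < \<sigma> * g s} = E \<sigma>"
      by (auto simp: E_def)
    finally show ?thesis .
  qed
  have lm: "E \<sigma> \<in> lmeasurable" for \<sigma>
    by (rule bounded_set_imp_lmeasurable) (use E_sets in \<open>auto simp: E_def bounded_iff intro!: exI[of _ "h/2"]\<close>)
  have "\<exists>\<sigma>. (\<sigma> = 1 \<or> \<sigma> = -1) \<and> measure lebesgue (E \<sigma>) \<noteq> 0"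
  proof (rule ccontr)
    assume "\<not> ?thesis"
    then have "E 1 \<in> null_sets lebesgue" "E (-1) \<in> null_sets lebesgue"
      using lm by (auto simp: null_sets_def emeasure_eq_measure2 E_sets)
    then have inner: "AE s in lebesgue. s \<notin> E 1" "AE s in lebesgue. s \<notin> E (-1)"
      by (simp_all add: AE_not_in)
    have "ennreal h * star_majorant g (h / 2) \<le> ennreal h * ennreal (C / h)"
      using star_majorant_half_step_le[OF g h(1)] C h by (simp add: ennreal_mult[symmetric])
    then have "star_majorant g (h / 2) \<le> ennreal (C / h)"
      using h by (subst (asm) ennreal_mult_le_mult_iff) auto
    also have "\<dots> \<le> ennreal (sup_norm g / 2)"
      using M h by (intro ennreal_leI) (simp add: field_simps)
    finally have outer: "star_majorant g (h / 2) \<le> ennreal (sup_norm g / 2)" .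
    have "AE t in lebesgue. \<bar>t\<bar> \<le> pi \<longrightarrow> ennreal \<bar>g t\<bar> \<le> ennreal (sup_norm g / 2)"
      using inner AE_le_star_majorant[of "h/2" g]
    proof eventually_elim
      case (elim t)
      show ?case
      proof (cases "\<bar>t\<bar> < h / 2")
        case True
        then have "\<bar>g t\<bar> \<le> sup_norm g / 2" using elim by (auto simp: E_def abs_le_iff)
        then show ?thesis by (simp add: ennreal_leI)
      next
        case False
        then show ?thesis using elim h outer by (auto intro: order_trans)
      qed
    qed
    then have "Linf_norm g \<le> ennreal (sup_norm g / 2)"
      unfolding Linf_norm_def
      by (intro esssup_I measurable_restrict_space1) (auto simp: AE_restrict_space_iff abs_le_iff elim!: eventually_mono)
    then show False
      using M by (simp add: Linf_norm_eq_sup_norm[OF g])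
  qed
  then obtain \<sigma> where "\<sigma> = 1 \<or> \<sigma> = -1" "measure lebesgue (E \<sigma>) \<noteq> 0" by blast
  moreover have "0 < measure lebesgue (E \<sigma>)" using calculation(2) measure_nonneg[of lebesgue "E \<sigma>"] by linarith
  ultimately show thesis by (intro that[of \<sigma> "E \<sigma>"] E_def lm)
qed

section \<open>A lattice of humps\<close>

text \<open>The test function that sees the norm of the kernel at all lattice points \<open>j h\<close> simultaneously:
  it is the normalised indicator of the reflected copies of the peak set \<open>E\<close> around \<open>h \<int>\<close>,
  with the sign of the peak. By
  duality of \<open>L\<^sup>1\<close> and \<open>L\<^sup>\<infinity>\<close>, the copy nearest to a lattice point contributes a fixed fraction of
  \<open>\<epsilon> \<parallel>g\<parallel>\<^sub>\<infinity> / N\<close> there, and the remaining copies are harmless by the bound on translates. Since the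
  function is \<open>h\<close>-periodic, all lattice points give the same value, and it suffices to compute at
  the origin.\<close>

lemma hump_exists:
  fixes N :: nat
  assumes g: "g \<in> Linf_circle"
    and C: "(\<integral>\<^sup>+x. star_majorant g x \<partial>circle_measure) \<le> ennreal C" "0 \<le> C"
    and N: "1 \<le> N" and h_def: "h = 2 * pi / N"
    and M: "0 < sup_norm g" "8 * C \<le> sup_norm g * h" and \<epsilon>: "0 < \<epsilon>"
  obtains f b where "periodic_2pi f" "f \<in> borel_measurable lebesgue" "\<And>t. \<bar>f t\<bar> \<le> b"
    "(\<integral>\<^sup>+t. ennreal \<bar>f t\<bar> \<partial>circle_measure) \<le> ennreal \<epsilon>"
    "\<And>j::int. \<epsilon> * sup_norm g / (12 * N) \<le> (\<integral>t. g (of_int j * h - t) * f t \<partial>circle_measure)"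
proof -
  note gm [measurable] = Linf_circle_measurable_lebesgue[OF g]
  have h: "0 < h" "h \<le> 2 * pi" "N * h = 2 * pi" using N by (auto simp: h_def field_simps)
  have "2 * C \<le> sup_norm g * h" using M(2) C(2) by linarith
  with g C h(1,2) M(1) obtain \<sigma> E where \<sigma>: "\<sigma> = 1 \<or> \<sigma> = (-1::real)"
    and E_eq: "E = {s. \<bar>s\<bar> < h / 2 \<and> sup_norm g / 2 < \<sigma> * g s}"
    and E: "E \<in> lmeasurable" "0 < measure lebesgue E"
    by (rule peak_set_exists)
  define m where "m = measure lebesgue E"
  have m: "0 < m" and emE: "emeasure lebesgue E = ennreal m"
    using E by (auto simp: m_def emeasure_eq_measure2)
  have E_sets: "E \<in> sets lebesgue" using E by auto
  have E_circle: "E \<subseteq> {-pi..pi}" using h by (auto simp: E_eq)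
  define T where "T = translates h E"
  have T: "T \<in> sets lebesgue" unfolding T_def by (rule sets_translates[OF E_sets])
  define S where "S = {t. \<exists>j::int. t - of_int j * h \<in> E}"
  have S_eq: "S = E \<union> T"
    by (auto simp: S_def T_def translates_def intro: exI[of _ 0])
       (metis diff_zero mult_zero_left of_int_0)
  have S [measurable]: "S \<in> sets lebesgue" using S_eq E_sets T by auto
  have S_shift: "t + of_int j * h \<in> S \<longleftrightarrow> t \<in> S" for t j
  proof
    assume "t + of_int j * h \<in> S"
    then obtain i where "t + of_int j * h - of_int i * h \<in> E" by (auto simp: S_def)
    then show "t \<in> S" unfolding S_def
      by (intro CollectI exI[of _ "i - j"]) (simp add: algebra_simps)
  next
    assume "t \<in> S"
    then obtain i where "t - of_int i * h \<in> E" by (auto simp: S_def)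
    then show "t + of_int j * h \<in> S" unfolding S_def
      by (intro CollectI exI[of _ "i + j"]) (simp add: algebra_simps)
  qed
  \<comment> \<open>About \<open>N\<close> copies of \<open>E\<close> meet \<open>[-\<pi>, \<pi>]\<close>. The crude count \<open>2 N + 1 \<le> 3 N\<close> suffices, whence the factor
    \<open>3\<close>.\<close>
  define a where "a = \<epsilon> / (3 * N * m)"
  have a: "0 < a" using \<epsilon> m N by (simp add: a_def)
  define f where "f t = \<sigma> * a * indicator S (- t)" for t
  have f_shift: "f (t - of_int j * h) = f t" for t j
    using S_shift[of "-t" j] by (simp add: f_def indicator_def add.commute)
  have f_per: "periodic_2pi f"
    unfolding periodic_2pi_def using f_shift[of _ "- int N"] h(3) by simp
  have f_meas: "f \<in> borel_measurable lebesgue"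
    unfolding f_def using measurable_lebesgue_reflect[of "\<lambda>t. indicator S t :: real" borel 0] by simp
  have f_le: "\<bar>f t\<bar> \<le> a" for t using \<sigma> a by (auto simp: f_def indicator_def)
  have f_L1: "(\<integral>\<^sup>+t. ennreal \<bar>f t\<bar> \<partial>circle_measure) \<le> ennreal \<epsilon>"
  proof -
    define B where "B j = {t. t - of_int j * h \<in> E}" for j :: int
    have B: "B j \<in> sets lebesgue" "emeasure lebesgue (B j) = ennreal m" for j
      unfolding B_def using translate_sets_lebesgue[OF E_sets] emeasure_lebesgue_translate[OF E_sets] emE
      by auto
    have sub: "S \<inter> {-pi..pi} \<subseteq> (\<Union>j\<in>{- int N..int N}. B j)"
    proof
      fix t assume "t \<in> S \<inter> {-pi..pi}"
      then obtain j :: int where j: "t - of_int j * h \<in> E" and t: "\<bar>t\<bar> \<le> pi" by (auto simp: S_def)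
      then have "\<bar>t - of_int j * h\<bar> < h / 2" by (simp add: E_eq)
      then have "\<bar>of_int j * h\<bar> < pi + h / 2" using t by linarith
      also have "\<dots> \<le> (real N + 1) * h" using h by (simp add: algebra_simps)
      finally have "\<bar>of_int j\<bar> < real N + 1" using h by (simp add: abs_mult)
      then have "\<bar>j\<bar> \<le> int N" by linarith
      then show "t \<in> (\<Union>j\<in>{- int N..int N}. B j)" using j by (intro UN_I[of j]) (auto simp: B_def)
    qed
    have "emeasure lebesgue (S \<inter> {-pi..pi}) \<le> emeasure lebesgue (\<Union>j\<in>{- int N..int N}. B j)"
      using B by (intro emeasure_mono sub) auto
    also have "\<dots> \<le> (\<Sum>j\<in>{- int N..int N}. emeasure lebesgue (B j))"
      using B by (intro emeasure_subadditive_finite) auto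
    also have "\<dots> = of_nat (2 * N + 1) * ennreal m"
    proof -
      have "card {- int N..int N} = 2 * N + 1" by simp
      then show ?thesis by (simp only: B sum_constant)
    qed
    also have "\<dots> = ennreal ((2 * N + 1) * m)"
      using m by (simp only: ennreal_of_nat_eq_real_of_nat) (subst ennreal_mult[symmetric], auto)
    also have "\<dots> \<le> ennreal (3 * N * m)"
      using N m by (intro ennreal_leI mult_right_mono) auto
    finally have em: "emeasure lebesgue (S \<inter> {-pi..pi}) \<le> ennreal (3 * N * m)" .
    have "(\<integral>\<^sup>+t. ennreal \<bar>f t\<bar> \<partial>circle_measure) = (\<integral>\<^sup>+t. ennreal a * indicator S (0 - t) \<partial>circle_measure)"
      using \<sigma> a by (intro nn_integral_cong) (auto simp: f_def indicator_def)
    also have "\<dots> = (\<integral>\<^sup>+t. ennreal a * indicator S t \<partial>circle_measure)"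
      using S_shift[of _ "int N"] h(3)
      by (intro nn_integral_circle_reflect[of "\<lambda>t. ennreal a * indicator S t"])
        (auto simp: periodic_2pi_def indicator_def)
    also have "\<dots> = (\<integral>\<^sup>+t. ennreal a * indicator (S \<inter> {-pi..pi}) t \<partial>lebesgue)"
      by (subst nn_integral_restrict_space) (auto intro!: nn_integral_cong simp: indicator_def)
    also have "\<dots> = ennreal a * emeasure lebesgue (S \<inter> {-pi..pi})"
      using S by (subst nn_integral_cmult_indicator) auto
    also have "\<dots> \<le> ennreal a * ennreal (3 * N * m)"
      by (intro mult_left_mono em) simp
    also have "\<dots> = ennreal \<epsilon>"
      using a m N by (subst ennreal_mult[symmetric]) (auto simp: a_def)
    finally show ?thesis .
  qed
  have peak: "\<epsilon> * sup_norm g / (12 * N) \<le> (\<integral>t. g (of_int j * h - t) * f t \<partial>circle_measure)" for j :: int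
  proof -
    define F where "F s = g s * f (- s)" for s
    have F_eq: "F s = \<sigma> * a * (g s * indicator S s)" for s
      by (simp add: F_def f_def)
    have F_per: "periodic_2pi F"
      using g S_shift[of _ "int N"] h(3)
      by (auto simp: F_eq periodic_2pi_def Linf_circle_def indicator_def)
    have fin: "finite_measure circle_measure" by (intro finite_measure_lebesgue_on) auto
    have g_int: "integrable circle_measure g"
      using AE_le_sup_norm[OF g] g
      by (intro finite_measure.integrable_const_bound[OF fin, of _ "sup_norm g"]) (auto simp: Linf_circle_def)
    have set_circle: "A \<in> sets lebesgue \<Longrightarrow> A \<inter> {-pi..pi} \<in> sets circle_measure" for A
      by (auto simp: sets_restrict_space_iff)
    have ind_int: "integrable circle_measure (\<lambda>s. u s * indicator A s)"
      if "integrable circle_measure u" "A \<in> sets lebesgue" for u :: "real \<Rightarrow> real" and A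
    proof -
      have "integrable circle_measure (\<lambda>s. indicator (A \<inter> {-pi..pi}) s *\<^sub>R u s)"
        by (rule integrable_mult_indicator[OF set_circle[OF that(2)] that(1)])
      then show ?thesis
        by (rule Bochner_Integration.integrable_cong[THEN iffD1, rotated -1]) (auto simp: indicator_def)
    qed
    have gS: "integrable circle_measure (\<lambda>s. g s * indicator S s)"
      and gT: "integrable circle_measure (\<lambda>s. \<bar>g s\<bar> * indicator T s)"
      and gE: "integrable circle_measure (\<lambda>s. sup_norm g / 2 * indicator E s)"
      using g_int S T E_sets finite_measure.integrable_const[OF fin] by (auto intro!: ind_int)
    have "F \<in> borel_measurable lebesgue" unfolding F_eq by measurable
    moreover have "integrable circle_measure F" unfolding F_eq using gS by simp
    ultimately have "(\<integral>t. F (of_int j * h - t) \<partial>circle_measure) = (\<integral>s. F s \<partial>circle_measure)"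
      by (intro integral_circle_reflect(2)[OF F_per])
    moreover have "F (of_int j * h - t) = g (of_int j * h - t) * f t" for t
      using f_shift[of t j] by (simp add: F_def)
    ultimately have "(\<integral>t. g (of_int j * h - t) * f t \<partial>circle_measure) = (\<integral>s. F s \<partial>circle_measure)"
      by (simp only:)
    also have "\<dots> = a * (\<integral>s. \<sigma> * (g s * indicator S s) \<partial>circle_measure)"
      by (simp add: F_eq mult.assoc mult.left_commute[of \<sigma> a])
    finally have eq: "(\<integral>t. g (of_int j * h - t) * f t \<partial>circle_measure)
        = a * (\<integral>s. \<sigma> * (g s * indicator S s) \<partial>circle_measure)" .
    have tail: "(\<integral>s. \<bar>g s\<bar> * indicator T s \<partial>circle_measure) \<le> m * (sup_norm g / 4)"
    proof -
      have "ennreal h * (\<integral>\<^sup>+s. ennreal (\<bar>g s\<bar> * indicator T s) \<partial>circle_measure)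
        = ennreal h * (\<integral>\<^sup>+s. ennreal \<bar>g s\<bar> * indicator T s \<partial>circle_measure)"
        by (intro arg_cong[where f="\<lambda>x. ennreal h * x"] nn_integral_cong) (auto simp: indicator_def)
      also have "\<dots> \<le> 2 * ennreal m * (\<integral>\<^sup>+x. star_majorant g x \<partial>circle_measure)"
        unfolding T_def emE[symmetric]
        by (intro nn_integral_translates_le[OF g h(1) E_sets]) (auto simp: E_eq)
      also have "\<dots> \<le> 2 * ennreal m * ennreal C"
        by (intro mult_left_mono C) simp
      also have "\<dots> = ennreal (2 * m * C)"
        using m C by (simp add: ennreal_mult)
      also have "\<dots> \<le> ennreal (h * (m * (sup_norm g / 4)))"
      proof (rule ennreal_leI)
        have "m * (8 * C) \<le> m * (sup_norm g * h)" using m M by (intro mult_left_mono) auto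
        then show "2 * m * C \<le> h * (m * (sup_norm g / 4))" by (simp add: mult_ac)
      qed
      also have "\<dots> = ennreal h * ennreal (m * (sup_norm g / 4))"
        using h m M by (intro ennreal_mult) auto
      finally have "(\<integral>\<^sup>+s. ennreal (\<bar>g s\<bar> * indicator T s) \<partial>circle_measure) \<le> ennreal (m * (sup_norm g / 4))"
        using h by (subst (asm) ennreal_mult_le_mult_iff) auto
      then show ?thesis
        using m M gT by (subst (asm) nn_integral_eq_integral) auto
    qed
    have main: "(\<integral>s. sup_norm g / 2 * indicator E s \<partial>circle_measure) = m * (sup_norm g / 2)"
    proof -
      have "measure circle_measure E = m"
        unfolding m_def using E_sets E_circle by (intro measure_restrict_space) auto
      moreover have "E \<in> sets circle_measure" using set_circle[OF E_sets] E_circle by (simp add: Int_absorb2)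
      ultimately show ?thesis using E_circle by (simp add: Int_absorb2 mult.commute)
    qed
    have "m * (sup_norm g / 4) = m * (sup_norm g / 2) - m * (sup_norm g / 4)" by simp
    also have "\<dots> \<le> (\<integral>s. sup_norm g / 2 * indicator E s \<partial>circle_measure)
        - (\<integral>s. \<bar>g s\<bar> * indicator T s \<partial>circle_measure)"
      using tail main by linarith
    also have "\<dots> = (\<integral>s. sup_norm g / 2 * indicator E s - \<bar>g s\<bar> * indicator T s \<partial>circle_measure)"
      using gE gT by (rule Bochner_Integration.integral_diff[symmetric])
    also have "\<dots> \<le> (\<integral>s. \<sigma> * (g s * indicator S s) \<partial>circle_measure)"
    proof (rule integral_mono)
      show "integrable circle_measure (\<lambda>s. \<sigma> * (g s * indicator S s))" using gS by simp
      fix s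
      \<comment> \<open>On \<open>E\<close> the peak dominates; elsewhere on \<open>S\<close> the point lies in \<open>T\<close>.\<close>
      show "sup_norm g / 2 * indicator E s - \<bar>g s\<bar> * indicator T s \<le> \<sigma> * (g s * indicator S s)"
        using \<sigma> by (auto simp: S_eq E_eq indicator_def)
    qed (use gE gT in auto)
    finally have "a * (m * (sup_norm g / 4)) \<le> a * (\<integral>s. \<sigma> * (g s * indicator S s) \<partial>circle_measure)"
      using a by (intro mult_left_mono) auto
    moreover have "a * (m * (sup_norm g / 4)) = \<epsilon> * sup_norm g / (12 * N)"
      using m N by (simp add: a_def field_simps)
    ultimately show ?thesis using eq by simp
  qed
  show thesis
    by (rule that[OF f_per f_meas f_le f_L1 peak])
qed

section \<open>Humps of small mass and large height\<close>

text \<open>The \<open>L\<^sup>\<infinity>\<close>--\<open>L\<^sup>1\<close> estimate of the convolution, used for the humps still to come.\<close>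

lemma integrable_kernel_product:
  assumes g: "g \<in> Linf_circle" and f: "f \<in> borel_measurable lebesgue"
    and e: "(\<integral>\<^sup>+t. ennreal \<bar>f t\<bar> \<partial>circle_measure) \<le> ennreal e" "0 \<le> e"
  shows "integrable circle_measure (\<lambda>t. g (y - t) * f t)"
    and "(\<integral>t. \<bar>g (y - t) * f t\<bar> \<partial>circle_measure) \<le> sup_norm g * e"
proof -
  note fc [measurable] = measurable_circle_of_lebesgue[OF f]
  note gc [measurable] = measurable_circle_of_lebesgue[OF measurable_lebesgue_reflect[OF Linf_circle_measurable_lebesgue[OF g]]]
  have "(\<integral>\<^sup>+t. ennreal (norm (g (y - t) * f t)) \<partial>circle_measure)
     \<le> (\<integral>\<^sup>+t. ennreal (sup_norm g) * ennreal \<bar>f t\<bar> \<partial>circle_measure)"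
    using AE_reflect_le_sup_norm[OF g, of y]
    by (intro nn_integral_mono_AE)
      (auto elim!: eventually_mono intro!: ennreal_leI mult_right_mono simp: ennreal_mult[symmetric] sup_norm_nonneg abs_mult)
  also have "\<dots> = ennreal (sup_norm g) * (\<integral>\<^sup>+t. ennreal \<bar>f t\<bar> \<partial>circle_measure)"
    by (intro nn_integral_cmult) measurable
  also have "\<dots> \<le> ennreal (sup_norm g) * ennreal e"
    by (intro mult_left_mono e) simp
  also have "\<dots> = ennreal (sup_norm g * e)"
    using e by (simp add: ennreal_mult sup_norm_nonneg)
  finally have le: "(\<integral>\<^sup>+t. ennreal (norm (g (y - t) * f t)) \<partial>circle_measure) \<le> ennreal (sup_norm g * e)" .
  show int: "integrable circle_measure (\<lambda>t. g (y - t) * f t)"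
    by (rule integrableI_bounded) (use le in \<open>auto intro: le_less_trans simp: less_top[symmetric] top_unique\<close>)
  show "(\<integral>t. \<bar>g (y - t) * f t\<bar> \<partial>circle_measure) \<le> sup_norm g * e"
    using le e nn_integral_eq_integral[OF integrable_norm[OF int]] by (simp add: sup_norm_nonneg)
qed

text \<open>The \<open>L\<^sup>1\<close>--\<open>L\<^sup>\<infinity>\<close> estimate, used for the humps already placed; it is uniform over the family
  of kernels.\<close>

lemma kernel_product_integral_le_bound:
  assumes g: "g \<in> Linf_circle" and L: "(\<integral>\<^sup>+t. ennreal \<bar>g t\<bar> \<partial>circle_measure) \<le> ennreal L" "0 \<le> L"
    and b: "\<And>t. \<bar>f t\<bar> \<le> b" and int: "integrable circle_measure (\<lambda>t. g (y - t) * f t)"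
  shows "\<bar>\<integral>t. g (y - t) * f t \<partial>circle_measure\<bar> \<le> L * b"
proof -
  note gm [measurable] = Linf_circle_measurable_lebesgue[OF g]
  note gc [measurable] = measurable_circle_of_lebesgue[OF measurable_lebesgue_reflect[OF gm]]
  have b0: "0 \<le> b" using b[of 0] by linarith
  have "ennreal \<bar>\<integral>t. g (y - t) * f t \<partial>circle_measure\<bar> \<le> (\<integral>\<^sup>+t. ennreal (norm (g (y - t) * f t)) \<partial>circle_measure)"
    using integral_norm_bound_ennreal[OF int] by simp
  also have "\<dots> \<le> (\<integral>\<^sup>+t. ennreal \<bar>g (y - t)\<bar> * ennreal b \<partial>circle_measure)"
    using b b0 by (intro nn_integral_mono) (auto simp: ennreal_mult[symmetric] abs_mult intro!: ennreal_leI mult_left_mono)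
  also have "\<dots> = (\<integral>\<^sup>+t. ennreal \<bar>g (y - t)\<bar> \<partial>circle_measure) * ennreal b"
    by (intro nn_integral_multc) measurable
  also have "(\<integral>\<^sup>+t. ennreal \<bar>g (y - t)\<bar> \<partial>circle_measure) = (\<integral>\<^sup>+t. ennreal \<bar>g t\<bar> \<partial>circle_measure)"
    using g by (intro nn_integral_circle_reflect[of "\<lambda>t. ennreal \<bar>g t\<bar>"]) (auto simp: periodic_2pi_def Linf_circle_def)
  also have "\<dots> * ennreal b \<le> ennreal L * ennreal b"
    by (intro mult_right_mono L) simp
  also have "\<dots> = ennreal (L * b)" using L b0 by (simp add: ennreal_mult)
  finally show ?thesis using L b0 by simp
qed

text \<open>Choose \<open>r\<close> with \<open>\<lambda>(r) \<parallel>\<phi>\<^sub>r\<parallel>\<^sub>\<infinity>\<close> large and a lattice of mesh \<open>h = 2\<pi>/N\<close> with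
  \<open>\<lambda>(r)/2 \<le> h \<le> \<lambda>(r)\<close>. The upper bound places a lattice point within \<open>\<lambda>(r)\<close> of every \<open>x\<close>; the lower
  bound makes the height \<open>\<epsilon> \<parallel>\<phi>\<^sub>r\<parallel>\<^sub>\<infinity> / (12 N)\<close> comparable with \<open>\<epsilon> \<lambda>(r) \<parallel>\<phi>\<^sub>r\<parallel>\<^sub>\<infinity>\<close>. Thus humps of
  arbitrarily small mass exceed any height \<open>K\<close>.\<close>

lemma spread_hump_exists:
  assumes \<phi>: "\<And>r. 0 < r \<Longrightarrow> r < 1 \<Longrightarrow> \<phi> r \<in> Linf_circle"
    and C: "\<And>r. 0 < r \<Longrightarrow> r < 1 \<Longrightarrow> (\<integral>\<^sup>+x. star_majorant (\<phi> r) x \<partial>circle_measure) \<le> ennreal C" "0 \<le> C"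
    and lam: "\<And>r. 0 < r \<Longrightarrow> r < 1 \<Longrightarrow> 0 < lam r" "(lam \<longlongrightarrow> 0) (at_left 1)"
    and Pi: "Pi_quantity lam \<phi> = \<infinity>"
    and \<epsilon>: "0 < \<epsilon>" and \<delta>: "\<delta> < 1"
  obtains r f b where "0 < r" "\<delta> < r" "r < 1" "periodic_2pi f" "f \<in> borel_measurable lebesgue"
    "\<And>t. \<bar>f t\<bar> \<le> b" "(\<integral>\<^sup>+t. ennreal \<bar>f t\<bar> \<partial>circle_measure) \<le> ennreal \<epsilon>"
    "\<And>x. \<exists>y\<in>{x - lam r..x + lam r}. K \<le> kernel_integral \<phi> r y f"
proof -
  \<comment> \<open>The first bound gives \<open>8 C \<le> \<parallel>\<phi>\<^sub>r\<parallel>\<^sub>\<infinity> h\<close>, which makes room for the contribution of the far copies, and the second gives the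
    height \<open>K\<close>.\<close>
  define c where "c = max (16 * C) (48 * pi * K / \<epsilon>)"
  have "\<not> (\<forall>\<^sub>F r in at_left 1. ennreal (lam r) * Linf_norm (\<phi> r) \<le> ennreal c)"
  proof
    assume "\<forall>\<^sub>F r in at_left 1. ennreal (lam r) * Linf_norm (\<phi> r) \<le> ennreal c"
    then have "Pi_quantity lam \<phi> \<le> ennreal c" unfolding Pi_quantity_def by (rule Limsup_bounded)
    then show False using Pi by (simp add: top_unique)
  qed
  moreover have "\<forall>\<^sub>F r in at_left 1. lam r < 1"
    by (rule order_tendstoD(2)[OF lam(2)]) simp
  moreover have "\<forall>\<^sub>F r in at_left 1. max 0 \<delta> < r \<and> r < (1::real)"
    using \<delta> by (auto simp: eventually_at_left_field intro!: exI[of _ "max 0 \<delta>"])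
  ultimately have "\<exists>\<^sub>F r in at_left 1. (\<not> ennreal (lam r) * Linf_norm (\<phi> r) \<le> ennreal c \<and> lam r < 1)
      \<and> max 0 \<delta> < r \<and> r < 1"
    unfolding not_eventually by (intro frequently_eventually_frequently)
  then obtain r where r: "\<not> ennreal (lam r) * Linf_norm (\<phi> r) \<le> ennreal c" "lam r < 1" "max 0 \<delta> < r" "r < 1"
    by (auto dest!: frequently_ex)
  define M where "M = sup_norm (\<phi> r)"
  have r01: "0 < r" "\<delta> < r" using r by auto
  note \<phi>r = \<phi>[OF r01(1) r(4)] and Cr = C(1)[OF r01(1) r(4)] and l0 = lam(1)[OF r01(1) r(4)]
  have "\<not> ennreal (lam r * M) \<le> ennreal c"
    using r(1) l0 by (simp add: Linf_norm_eq_sup_norm[OF \<phi>r] M_def ennreal_mult sup_norm_nonneg)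
  then have "c < lam r * M" by (meson ennreal_leI not_le)
  then have big: "16 * C < lam r * M" "48 * pi * K / \<epsilon> < lam r * M" by (auto simp: c_def)
  have M0: "0 < M" using big(1) C(2) l0 
    by (intro zero_less_mult_pos[of "lam r" M]) auto
  define N where "N = nat \<lceil>2 * pi / lam r\<rceil>"
  define h where "h = 2 * pi / N"
  have q: "1 < 2 * pi / lam r" using l0 r(2) pi_gt3 by (simp add: field_simps)
  have N: "2 * pi / lam r \<le> N" "N < 2 * pi / lam r + 1" using q unfolding N_def by linarith+
  have N1: "1 \<le> N" using N q by linarith
  have h: "h \<le> lam r" "lam r / 2 \<le> h" "0 < h"
  proof -
    show "h \<le> lam r" "0 < h" using N N1 l0 by (auto simp: h_def field_simps)
    have "N \<le> 2 * (2 * pi / lam r)" using N q by linarith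
    then show "lam r / 2 \<le> h" using N1 l0 by (simp add: h_def field_simps)
  qed
  have hM: "8 * C \<le> sup_norm (\<phi> r) * h"
  proof -
    have "lam r / 2 * M \<le> h * M" using h M0 by (intro mult_right_mono) auto
    then show ?thesis using big by (simp add: M_def mult.commute)
  qed
  obtain f b where f: "periodic_2pi f" "f \<in> borel_measurable lebesgue" "\<And>t. \<bar>f t\<bar> \<le> b"
    "(\<integral>\<^sup>+t. ennreal \<bar>f t\<bar> \<partial>circle_measure) \<le> ennreal \<epsilon>"
    and peak: "\<And>j::int. \<epsilon> * sup_norm (\<phi> r) / (12 * N) \<le> (\<integral>t. \<phi> r (of_int j * h - t) * f t \<partial>circle_measure)"
    by (rule hump_exists[OF \<phi>r Cr C(2) N1 h_def M0[unfolded M_def] hM \<epsilon>]) blast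
  have "K \<le> \<epsilon> * (lam r * M) / (48 * pi)"
    using big(2) \<epsilon> by (simp add: field_simps)
  also have "\<dots> = \<epsilon> * M * (lam r / 2) / (24 * pi)" by simp
  also have "\<dots> \<le> \<epsilon> * M * h / (24 * pi)"
    using h(2) \<epsilon> M0 by (intro divide_right_mono mult_left_mono) auto
  also have "\<dots> = \<epsilon> * sup_norm (\<phi> r) / (12 * N)"
    using N1 by (simp add: h_def M_def)
  finally have K: "K \<le> \<epsilon> * sup_norm (\<phi> r) / (12 * N)" .
  have "\<exists>y\<in>{x - lam r..x + lam r}. K \<le> kernel_integral \<phi> r y f" for x
  proof
    define j where "j = \<lfloor>x / h\<rfloor>"
    have "of_int j \<le> x / h" "x / h < of_int j + 1" unfolding j_def by linarith+
    then have "of_int j * h \<le> x" "x < of_int j * h + h" using h by (auto simp: field_simps)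
    then show "of_int j * h \<in> {x - lam r..x + lam r}" using h by auto
    show "K \<le> kernel_integral \<phi> r (of_int j * h) f"
      unfolding kernel_integral_def using K peak[of j] by linarith
  qed
  then show thesis using that[OF r01 r(4) f] by blast
qed

section \<open>Superposition of humps\<close>

text \<open>Recursive choice of the humps. Each one is chosen after its predecessors: its height beats
  \<open>L\<close> times the sum of their sup bounds, which limits what they can contribute, and its mass
  \<open>e (n + 1)\<close> is at most the reciprocal of the norm of the preceding kernel, so that it changes the
  height already achieved by a bounded amount only.\<close>

lemma gliding_hump_sequence:
  assumes \<phi>: "\<And>r. 0 < r \<Longrightarrow> r < 1 \<Longrightarrow> \<phi> r \<in> Linf_circle"
    and C: "\<And>r. 0 < r \<Longrightarrow> r < 1 \<Longrightarrow> (\<integral>\<^sup>+x. star_majorant (\<phi> r) x \<partial>circle_measure) \<le> ennreal C" "0 \<le> C"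
    and lam: "\<And>r. 0 < r \<Longrightarrow> r < 1 \<Longrightarrow> 0 < lam r" "(lam \<longlongrightarrow> 0) (at_left 1)"
    and Pi: "Pi_quantity lam \<phi> = \<infinity>"
  obtains r :: "nat \<Rightarrow> real" and f :: "nat \<Rightarrow> real \<Rightarrow> real" and b e :: "nat \<Rightarrow> real" where
    "\<And>n. 0 < r n" "\<And>n. r n < 1" "\<And>n. 1 - 1 / (real n + 1) < r (Suc n)"
    "\<And>n. periodic_2pi (f n)" "\<And>n. f n \<in> borel_measurable lebesgue" "\<And>n t. \<bar>f n t\<bar> \<le> b n"
    "\<And>n. (\<integral>\<^sup>+t. ennreal \<bar>f n t\<bar> \<partial>circle_measure) \<le> ennreal (e n)"
    "\<And>n. 0 < e n" "\<And>n. e (Suc n) \<le> e n / 2" "\<And>n. sup_norm (\<phi> (r n)) * e (Suc n) \<le> 1"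
    "\<And>n x. \<exists>y\<in>{x - lam (r (Suc n))..x + lam (r (Suc n))}.
        L * (\<Sum>j\<le>n. b j) + n + 2 \<le> kernel_integral \<phi> (r (Suc n)) y (f (Suc n))"
proof -
  \<comment> \<open>A state consists of a parameter, a hump, its sup bound, its mass bound, and the sum \<open>s\<close> of all
    sup bounds so far, since the next height depends on the whole history only through \<open>s\<close>.\<close>
  define P where "P n u \<longleftrightarrow> (case u of (r, f, b, e, s) \<Rightarrow> 0 < r \<and> r < 1 \<and> periodic_2pi f \<and>
      f \<in> borel_measurable lebesgue \<and> (\<forall>t. \<bar>f t\<bar> \<le> b) \<and>
      (\<integral>\<^sup>+t. ennreal \<bar>f t\<bar> \<partial>circle_measure) \<le> ennreal e \<and> 0 < e \<and> (n = 0 \<longrightarrow> s = b))"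
    for n :: nat and u :: "real \<times> (real \<Rightarrow> real) \<times> real \<times> real \<times> real"
  define Q where "Q n u v \<longleftrightarrow> (case u of (r, f, b, e, s) \<Rightarrow> case v of (r', f', b', e', s') \<Rightarrow>
      1 - 1 / (real n + 1) < r' \<and> e' \<le> e / 2 \<and> sup_norm (\<phi> r) * e' \<le> 1 \<and> s' = s + b' \<and>
      (\<forall>x. \<exists>y\<in>{x - lam r'..x + lam r'}. L * s + n + 2 \<le> kernel_integral \<phi> r' y f'))"
    for n :: nat and u v :: "real \<times> (real \<Rightarrow> real) \<times> real \<times> real \<times> real"
  have "\<exists>u. \<forall>n. P n (u n) \<and> Q n (u n) (u (Suc n))"
  proof (rule dependent_nat_choice)
    \<comment> \<open>No height is demanded at index \<open>0\<close>, so the zero function starts the recursion.\<close>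
    have "P 0 (1/2, (\<lambda>_. 0), 0, 1, 0)" by (simp add: P_def periodic_2pi_def)
    then show "\<exists>u. P 0 u" by blast
  next
    fix u n assume P: "P n u"
    obtain r f b e s where u: "u = (r, f, b, e, s)" by (cases u) auto
    define e' where "e' = min (e / 2) (1 / (sup_norm (\<phi> r) + 1))"
    have e': "0 < e'" "e' \<le> e / 2" using P sup_norm_nonneg[of "\<phi> r"] by (auto simp: P_def u e'_def)
    have "sup_norm (\<phi> r) * e' \<le> sup_norm (\<phi> r) * (1 / (sup_norm (\<phi> r) + 1))"
      by (intro mult_left_mono sup_norm_nonneg) (simp add: e'_def)
    also have "\<dots> \<le> 1" using sup_norm_nonneg[of "\<phi> r"] by (simp add: field_simps)
    finally have "sup_norm (\<phi> r) * e' \<le> 1" .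
    moreover have "1 - 1 / (real n + 1) < 1" by simp
    then obtain r' f' b' where "0 < r'" "1 - 1 / (real n + 1) < r'" "r' < 1"
      "periodic_2pi f'" "f' \<in> borel_measurable lebesgue" "\<And>t. \<bar>f' t\<bar> \<le> b'"
      "(\<integral>\<^sup>+t. ennreal \<bar>f' t\<bar> \<partial>circle_measure) \<le> ennreal e'"
      "\<And>x. \<exists>y\<in>{x - lam r'..x + lam r'}. L * s + n + 2 \<le> kernel_integral \<phi> r' y f'"
      using spread_hump_exists[OF \<phi> C lam Pi e'(1), where K="L * s + n + 2"] by metis
    ultimately have "P (Suc n) (r', f', b', e', s + b') \<and> Q n u (r', f', b', e', s + b')"
      using e' by (simp add: P_def Q_def u)
    then show "\<exists>v. P (Suc n) v \<and> Q n u v" by blast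
  qed
  then obtain u where u: "\<And>n. P n (u n)" "\<And>n. Q n (u n) (u (Suc n))" by blast
  define r where "r n = fst (u n)" for n
  define f where "f n = fst (snd (u n))" for n
  define b where "b n = fst (snd (snd (u n)))" for n
  define e where "e n = fst (snd (snd (snd (u n))))" for n
  define s where "s n = snd (snd (snd (snd (u n))))" for n
  have un: "u n = (r n, f n, b n, e n, s n)" for n by (simp add: r_def f_def b_def e_def s_def)
  have s: "s n = (\<Sum>j\<le>n. b j)" for n
  proof (induction n)
    case 0
    show ?case using u(1)[of 0] by (simp add: P_def un)
  next
    case (Suc n)
    then show ?case using u(2)[of n] by (simp add: Q_def un)
  qed
  show thesis
    by (rule that[of r f b e]) (use u in \<open>auto simp: P_def Q_def un s\<close>)
qed

text \<open>The sum of the humps works. At the parameter \<open>r (n + 1)\<close>, the humps up to \<open>n\<close> contribute at most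
  \<open>L\<close> times the sum of their sup bounds, and the humps after \<open>n + 1\<close> at most a geometric series with
  sum \<open>2\<close>. The height of hump \<open>n + 1\<close> exceeds both together by \<open>n\<close>.\<close>

lemma hump_series_diverges:
  fixes \<phi> :: "real \<Rightarrow> real \<Rightarrow> real" and lam :: "real \<Rightarrow> real"
  assumes \<phi>: "\<And>r. 0 < r \<Longrightarrow> r < 1 \<Longrightarrow> \<phi> r \<in> Linf_circle"
    and L: "\<And>r. 0 < r \<Longrightarrow> r < 1 \<Longrightarrow> (\<integral>\<^sup>+t. ennreal \<bar>\<phi> r t\<bar> \<partial>circle_measure) \<le> ennreal L" "0 \<le> L"
    and r: "\<And>n. 0 < r n" "\<And>n. r n < 1" "\<And>n. 1 - 1 / (real n + 1) < r (Suc n)"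
    and f: "\<And>n. periodic_2pi (f n)" "\<And>n. f n \<in> borel_measurable lebesgue"
    and b: "\<And>n t. \<bar>f n t\<bar> \<le> b n"
    and e: "\<And>n. (\<integral>\<^sup>+t. ennreal \<bar>f n t\<bar> \<partial>circle_measure) \<le> ennreal (e n)" "\<And>n. 0 < e n"
      "\<And>n. e (Suc n) \<le> e n / 2" "\<And>n. sup_norm (\<phi> (r n)) * e (Suc n) \<le> 1"
    and peak: "\<And>n x. \<exists>y\<in>{x - lam (r (Suc n))..x + lam (r (Suc n))}.
        L * (\<Sum>j\<le>n. b j) + n + 2 \<le> kernel_integral \<phi> (r (Suc n)) y (f (Suc n))"
  shows "\<exists>F \<in> L1_circle. \<forall>x. approach_limsup lam (\<lambda>r y. kernel_integral \<phi> r y F) x = \<infinity>"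
proof -
  have e_geom: "e (m + i) \<le> e m * (1 / 2) ^ i" for m i
  proof (induction i)
    case (Suc i)
    then show ?case using e(3)[of "m + i"] by simp
  qed simp
  have e_sum: "summable e"
  proof (rule summable_comparison_test')
    show "summable (\<lambda>i. e 0 * (1 / 2) ^ i)" by (intro summable_mult summable_geometric) simp
    show "norm (e i) \<le> e 0 * (1 / 2) ^ i" for i
      using e_geom[of 0 i] e(2)[of i] by (simp only: real_norm_def add_0)
  qed
  note fc = measurable_circle_of_lebesgue[OF f(2)]
  have f_int: "integrable circle_measure (f n)" for n
    using fc e(1)[of n] by (intro integrableI_bounded) (auto intro: le_less_trans)
  have f_L1: "(\<integral>t. \<bar>f n t\<bar> \<partial>circle_measure) \<le> e n" for n
    using e(1)[of n] nn_integral_eq_integral[OF integrable_norm[OF f_int[of n]]] less_imp_le[OF e(2)] by simp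
  \<comment> \<open>Pointwise convergence of the series of humps holds almost everywhere by monotone convergence.
    Elsewhere the sum has a default value; it is still \<open>2\<pi>\<close>-periodic there, since the terms are.\<close>
  have f_summable: "AE t in circle_measure. summable (\<lambda>n. \<bar>f n t\<bar>)"
  proof -
    have "(\<integral>\<^sup>+t. (\<Sum>n. ennreal \<bar>f n t\<bar>) \<partial>circle_measure) = (\<Sum>n. \<integral>\<^sup>+t. ennreal \<bar>f n t\<bar> \<partial>circle_measure)"
      using fc by (intro nn_integral_suminf) auto
    also have "\<dots> \<le> (\<Sum>n. ennreal (e n))"
      by (intro suminf_le e) auto
    also have "\<dots> < \<infinity>"
      using e_sum less_imp_le[OF e(2)] by (simp add: ennreal_suminf_neq_top less_top[symmetric])
    finally have "AE t in circle_measure. (\<Sum>n. ennreal \<bar>f n t\<bar>) \<noteq> \<infinity>"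
      using fc by (intro nn_integral_PInf_AE) auto
    then show ?thesis
      by eventually_elim (auto intro: summable_suminf_not_top)
  qed
  define F where "F t = (\<Sum>n. f n t)" for t
  have F_meas: "F \<in> borel_measurable circle_measure"
    unfolding F_def using fc by measurable
  have "summable (\<lambda>n. \<integral>t. norm (f n t) \<partial>circle_measure)"
    by (rule summable_comparison_test'[OF e_sum, of 0]) (use f_L1 in simp)
  then have "integrable circle_measure F"
    unfolding F_def using f_int f_summable by (intro integrable_suminf) auto
  moreover have "periodic_2pi F" using f(1) by (simp add: periodic_2pi_def F_def)
  ultimately have F: "F \<in> L1_circle" by (simp add: L1_circle_def)
  have large: "\<exists>y\<in>{x - lam (r (Suc n))..x + lam (r (Suc n))}. n \<le> kernel_integral \<phi> (r (Suc n)) y F" for n x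
  proof -
    obtain y where y: "y \<in> {x - lam (r (Suc n))..x + lam (r (Suc n))}"
      "L * (\<Sum>j\<le>n. b j) + n + 2 \<le> kernel_integral \<phi> (r (Suc n)) y (f (Suc n))"
      using peak by blast
    define g where "g = \<phi> (r (Suc n))"
    have g: "g \<in> Linf_circle" using \<phi> r by (simp add: g_def)
    have gL: "(\<integral>\<^sup>+t. ennreal \<bar>g t\<bar> \<partial>circle_measure) \<le> ennreal L" using L(1) r by (simp add: g_def)
    define a where "a j = (\<integral>t. g (y - t) * f j t \<partial>circle_measure)" for j
    note prod = integrable_kernel_product[OF g f(2) e(1) less_imp_le[OF e(2)], of y]
    have a_early: "\<bar>a j\<bar> \<le> L * b j" for j
      unfolding a_def by (rule kernel_product_integral_le_bound[OF g gL L(2) b prod(1)])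
    have a_late: "\<bar>a j\<bar> \<le> sup_norm g * e j" for j
      unfolding a_def using prod(2)[of j] integral_abs_bound[of circle_measure "\<lambda>t. g (y - t) * f j t"] by linarith
    have "a sums (\<integral>t. (\<Sum>j. g (y - t) * f j t) \<partial>circle_measure)"
      unfolding a_def
    proof (rule sums_integral[OF prod(1)])
      show "AE t in circle_measure. summable (\<lambda>j. norm (g (y - t) * f j t))"
        using f_summable by eventually_elim (simp add: abs_mult summable_mult)
      show "summable (\<lambda>j. \<integral>t. norm (g (y - t) * f j t) \<partial>circle_measure)"
        by (rule summable_comparison_test'[OF summable_mult[OF e_sum, of "sup_norm g"], of 0])
          (use prod(2) in simp)
    qed
    also have "(\<integral>t. (\<Sum>j. g (y - t) * f j t) \<partial>circle_measure) = kernel_integral \<phi> (r (Suc n)) y F"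
      unfolding kernel_integral_def g_def[symmetric]
    proof (rule integral_cong_AE)
      have gc: "(\<lambda>t. g (y - t)) \<in> borel_measurable circle_measure"
        by (intro measurable_circle_of_lebesgue measurable_lebesgue_reflect Linf_circle_measurable_lebesgue g)
      show "(\<lambda>t. \<Sum>j. g (y - t) * f j t) \<in> borel_measurable circle_measure"
        using gc fc by measurable
      show "(\<lambda>t. g (y - t) * F t) \<in> borel_measurable circle_measure"
        using gc F_meas by measurable
      show "AE t in circle_measure. (\<Sum>j. g (y - t) * f j t) = g (y - t) * F t"
        using f_summable
        by eventually_elim (auto simp: F_def intro!: suminf_mult summable_rabs_cancel)
    qed
    finally have sums: "a sums kernel_integral \<phi> (r (Suc n)) y F" .
    define m where "m = Suc (Suc n)"
    have split: "kernel_integral \<phi> (r (Suc n)) y F = (\<Sum>i. a (i + m)) + sum a {..<m}"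
      using suminf_split_initial_segment[OF sums_summable[OF sums], of m] sums_unique[OF sums] by simp
    have late: "\<bar>\<Sum>i. a (i + m)\<bar> \<le> 2"
    proof -
      have le: "\<bar>a (i + m)\<bar> \<le> (1 / 2) ^ i" for i
      proof -
        have "\<bar>a (i + m)\<bar> \<le> sup_norm g * (e m * (1 / 2) ^ i)"
          using a_late[of "i + m"] mult_left_mono[OF e_geom[of m i] sup_norm_nonneg[of g]] by (simp add: add.commute)
        also have "\<dots> = (sup_norm g * e m) * (1 / 2) ^ i" by simp
        also have "\<dots> \<le> 1 * (1 / 2) ^ i"
          using e(4)[of "Suc n"] by (intro mult_right_mono) (auto simp: g_def m_def)
        finally show ?thesis by simp
      qed
      have geo: "summable (\<lambda>i. (1 / 2 :: real) ^ i)" by simp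
      have "summable (\<lambda>i. \<bar>a (i + m)\<bar>)"
        by (rule summable_comparison_test'[OF geo, of 0]) (use le in simp)
      then have "\<bar>\<Sum>i. a (i + m)\<bar> \<le> (\<Sum>i. \<bar>a (i + m)\<bar>)" by (rule summable_rabs)
      also have "\<dots> \<le> (\<Sum>i. (1 / 2 :: real) ^ i)"
        by (rule suminf_le[OF le \<open>summable (\<lambda>i. \<bar>a (i + m)\<bar>)\<close> geo])
      also have "\<dots> = 2" by (simp add: suminf_geometric)
      finally show ?thesis .
    qed
    have early: "\<bar>\<Sum>j\<le>n. a j\<bar> \<le> L * (\<Sum>j\<le>n. b j)"
      unfolding sum_distrib_left by (rule order_trans[OF sum_abs sum_mono[OF a_early]])
    have "sum a {..<m} = (\<Sum>j\<le>n. a j) + a (Suc n)"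
      by (simp add: m_def lessThan_Suc_atMost)
    moreover have "a (Suc n) = kernel_integral \<phi> (r (Suc n)) y (f (Suc n))"
      by (simp add: a_def g_def kernel_integral_def)
    ultimately have "n \<le> kernel_integral \<phi> (r (Suc n)) y F"
      using split late early y(2) by linarith
    then show ?thesis using y(1) by blast
  qed
  have "approach_limsup lam (\<lambda>r y. kernel_integral \<phi> r y F) x = \<infinity>" for x
  proof (rule ccontr)
    define u where "u r = (SUP y\<in>{x - lam r..x + lam r}. ereal (kernel_integral \<phi> r y F))" for r
    assume "approach_limsup lam (\<lambda>r y. kernel_integral \<phi> r y F) x \<noteq> \<infinity>"
    then obtain c :: nat where "Limsup (at_left 1) u < ereal c"
      unfolding approach_limsup_def u_def[symmetric] by (metis PInfty_neq_ereal(2) ereal_less_PInfty less_PInf_Ex_of_nat)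
    then have "\<forall>\<^sub>F r in at_left 1. u r < ereal c" by (rule Limsup_lessD)
    then obtain d where d: "d < 1" "\<And>r. d < r \<Longrightarrow> r < 1 \<Longrightarrow> u r < ereal c"
      by (auto simp: eventually_at_left_field)
    obtain k where k: "inverse (real (Suc k)) < 1 - d" using reals_Archimedean[of "1 - d"] d(1) by auto
    define n where "n = max c k"
    have "1 / (real n + 1) \<le> inverse (real (Suc k))"
      unfolding n_def by (simp add: field_simps)
    then have "d < r (Suc n)" using k r(3)[of n] by linarith
    then have "u (r (Suc n)) < ereal c" using d r by blast
    moreover obtain y where "y \<in> {x - lam (r (Suc n))..x + lam (r (Suc n))}" "n \<le> kernel_integral \<phi> (r (Suc n)) y F"
      using large by blast
    then have "ereal n \<le> u (r (Suc n))"
      unfolding u_def by (intro SUP_upper2[of y]) auto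
    moreover have "ereal c \<le> ereal n" by (simp add: n_def)
    ultimately show False by (meson leD order_trans)
  qed
  then show ?thesis using F by blast
qed

theorem theorem1p3:
  fixes \<phi> :: "real \<Rightarrow> real \<Rightarrow> real" and lam :: "real \<Rightarrow> real"
  assumes "approximate_identity \<phi>"
    and "\<And>r. 0 < r \<Longrightarrow> r < 1 \<Longrightarrow> lam r > 0"
    and "(lam \<longlongrightarrow> 0) (at_left 1)"
    and "Pi_quantity lam \<phi> = \<infinity>"
  shows "\<exists>f \<in> L1_circle. \<forall>x. approach_limsup lam (\<lambda>r y. kernel_integral \<phi> r y f) x = \<infinity>"
proof -
  have \<phi>: "\<phi> r \<in> Linf_circle" if "0 < r" "r < 1" for r
    using assms(1) that by (auto simp: approximate_identity_def)
  define C where "C = enn2real (SUP r\<in>{0<..<1}. \<integral>\<^sup>+x. star_majorant (\<phi> r) x \<partial>circle_measure)"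
  have "(SUP r\<in>{0<..<1}. \<integral>\<^sup>+x. star_majorant (\<phi> r) x \<partial>circle_measure) = ennreal C"
    using assms(1) by (auto simp: approximate_identity_def C_def)
  then have C: "(\<integral>\<^sup>+x. star_majorant (\<phi> r) x \<partial>circle_measure) \<le> ennreal C" if "0 < r" "r < 1" for r
    using that by (metis SUP_upper greaterThanLessThan_iff)
  have C0: "0 \<le> C" by (simp add: C_def)
  define L where "L = 2 * C + 1"
  have L0: "0 \<le> L" using C0 by (simp add: L_def)
  have L: "(\<integral>\<^sup>+t. ennreal \<bar>\<phi> r t\<bar> \<partial>circle_measure) \<le> ennreal L" if "0 < r" "r < 1" for r
    unfolding L_def by (rule nn_integral_Linf_circle_le[OF \<phi>[OF that] C[OF that] C0])
  show ?thesis
    apply (rule gliding_hump_sequence[where \<phi>=\<phi> and C=C and lam=lam and L=L])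
          apply (fact \<phi> C C0 assms)+
    subgoal premises seq for r f b e
      by (rule hump_series_diverges[OF \<phi> L L0 seq])
    done
qed

end
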